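(* Let $E$ be a graph, $v,w\in E^0$, and let $\theta\colon s_E^{-1}(v)\to s_E^{-1}(w)$ be a map such that $s_E^{-1}(v)=\{y\}$ and $t_E(y)=t_E(\theta(y))$. Let $E_{(v,w)}$ be the corresponding shift and let $f_*\colon C^*(E)\to C^*(E_{(v,w)})$ be the $*$-isomorphism with $f_*(S_u)=S_u$ for $u\in E^0$, $f_*(S_e)=S_e$ for $e\in E^1\setminus\{\theta(y)\}$, $f_*(S_{\theta(y)})=S_{x_{w,v}}S_y$, whose inverse is given by $(f_* )^{-1}(S_e)=S_e$ for all vertices and all edges $e\neq x_{w,v}$, and $(f_* )^{-1}(S_{x_{w,v}})=S_{\theta(y)}S_y^*$. Then the maps $\varphi^0\colon E_{(v,w)}^0\to S(E)$ and $\varphi^1\colon E_{(v,w)}^1\to S(E)$ given by $$\varphi^0(u)=\begin{cases}(u,u)& u\ne v\\ (y,y)&u=v\end{cases},\qquad \varphi^1(e)=\begin{cases}(e,t_E(e))& e\ne x_{w,v},\ t_E(e)\neq v\\ (ey,y)& e\neq x_{w,v},\ t_E(e)=v\\ (\theta(y),y)& e=x_{w,v}\end{cases}$$ determine a regular extended path homomorphism of graphs $\varphi\colon S(E_{(v,w)})\to S(E)$ that covariantly induces the inverse $*$-homomorphism: $\varphi_*=(f_* )^{-1}$.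
   Context: A graph $E=(E^0,E^1,s_E,t_E)$ consists of arbitrary sets of vertices and edges with source and target maps. A vertex $v$ is regular if $s_E^{-1}(v)$ is finite and nonempty; $\mathrm{reg}(E)$ is the set of regular vertices. $\mathrm{FP}(E)$ is the set of finite paths (vertices, of length $0$, and sequences $e_1\ldots e_n$ of edges with $t_E(e_i)=s_E(e_{i+1})$); vertices act as units for concatenation. Shift: $E_{(v,w)}^0=E^0$, $E_{(v,w)}^1=(E^1\setminus\theta(s_E^{-1}(v)))\sqcup\{x_{w,v}\}$, sources and targets of the edges in $E^1\setminus\theta(s_E^{-1}(v))$ are as in $E$, and the new edge $x_{w,v}$ has source $w$ and target $v$. $C^*(E)$ is the universal C*-algebra generated by mutually orthogonal projections $S_v$ ($v\in E^0$) and elements $S_e$ ($e\in E^1$) with $S_e^*S_{e'}=\delta_{e,e'}S_{t_E(e)}$, $S_{s_E(e)}S_e=S_e$, and $S_v=\sum_{e\in s_E^{-1}(v)}S_eS_e^*$ for $v\in\mathrm{reg}(E)$. For paths, $S_{e_1\ldots e_n}=S_{e_1}\cdots S_{e_n}$; put $S_{(\alpha,\beta)}=S_\alpha S_\beta^*$, $S_0=0$. That $f_*$ in the claim is a $*$-isomorphism with the stated inverse is quoted from the literature. The graph inverse semigroup is $S(E)=\{(\alpha,\beta)\in \mathrm{FP}(E)^2\mid t_E(\alpha)=t_E(\beta)\}\cup\{0\}$ with $(\alpha,\beta)(\gamma,\delta)=(\alpha\gamma',\delta)$ if $\gamma=\beta\gamma'$, $=(\alpha,\delta\beta')$ if $\beta=\gamma\beta'$,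 and $=0$ otherwise; $0$ is a zero element. It is an inverse semigroup with $(\alpha,\beta)^*=(\beta,\alpha)$ and natural order $s\le t\iff ss^*t=s$. An extended path homomorphism from $E$ to $F$ is a semigroup homomorphism $\varphi\colon S(E)\to S(F)$ with $\varphi(0)=0$. Maps $\varphi^0\colon E^0\to S(F)$, $\varphi^1\colon E^1\to S(F)$ determine $\varphi$ if $\varphi$ is the (necessarily unique) extended path homomorphism with $\varphi(v,v)=\varphi^0(v)$ and $\varphi(e,t_E(e))=\varphi^1(e)$. $\varphi$ is regular if whenever $u\in\mathrm{reg}(E)$, $0\ne t\in S(F)$ and $t\le\varphi(u,u)$, there exists $e\in s_E^{-1}(u)$ with $t\varphi(e,e)\neq0$. A regular $\varphi$ induces the $*$-homomorphism $\varphi_*\colon C^*(E)\to C^*(F)$, $S_v\mapsto S_{\varphi(v,v)}$, $S_e\mapsto S_{\varphi(e,t_E(e))}$. *)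

theory Defs
  imports
    "Graph_Theory.Graph_Theory"
    "HOL-Library.Poly_Mapping"
    "HOL-Library.Sublist"
    "HOL-Library.FuncSet"
    "HOL-Analysis.Analysis"
begin

section \<open>Star-algebras and universal C*-algebras\<close>

record 'a star_algebra =
  sa_carrier :: "'a set"
  sa_zero :: 'a
  sa_add :: "'a \<Rightarrow> 'a \<Rightarrow> 'a"
  sa_scale :: "complex \<Rightarrow> 'a \<Rightarrow> 'a"
  sa_mult :: "'a \<Rightarrow> 'a \<Rightarrow> 'a"
  sa_star :: "'a \<Rightarrow> 'a"
  sa_norm :: "'a \<Rightarrow> real"

definition star_hom ::
  "('a, 'm) star_algebra_scheme \<Rightarrow> ('b, 'n) star_algebra_scheme \<Rightarrow> ('a \<Rightarrow> 'b) \<Rightarrow> bool" where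
  "star_hom A B h \<longleftrightarrow>
     h \<in> sa_carrier A \<rightarrow> sa_carrier B \<and>
     (\<forall>x\<in>sa_carrier A. \<forall>y\<in>sa_carrier A. h (sa_add A x y) = sa_add B (h x) (h y)) \<and>
     (\<forall>c. \<forall>x\<in>sa_carrier A. h (sa_scale A c x) = sa_scale B c (h x)) \<and>
     (\<forall>x\<in>sa_carrier A. \<forall>y\<in>sa_carrier A. h (sa_mult A x y) = sa_mult B (h x) (h y)) \<and>
     (\<forall>x\<in>sa_carrier A. h (sa_star A x) = sa_star B (h x))"

definition star_iso ::
  "('a, 'm) star_algebra_scheme \<Rightarrow> ('b, 'n) star_algebra_scheme \<Rightarrow> ('a \<Rightarrow> 'b) \<Rightarrow> bool" where
  "star_iso A B h \<longleftrightarrow> star_hom A B h \<and> bij_betw h (sa_carrier A) (sa_carrier B)"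

text \<open>
  Words in the letters \<open>g\<close> and \<open>g\<^sup>*\<close>; the letter \<open>(g, False)\<close> stands for the generator \<open>g\<close>
  and \<open>(g, True)\<close> for its formal adjoint. The wrapper type makes concatenation an instance of
  \<^class>\<open>monoid_add\<close>, so that finitely supported functions on words, with the convolution
  product of \<^theory>\<open>HOL-Library.Poly_Mapping\<close>, form the unital free complex *-algebra.
\<close>

datatype 'g star_word = Word (letters: "('g \<times> bool) list")

instantiation star_word :: (type) monoid_add
begin

definition zero_star_word :: "'a star_word" where
  "0 = Word []"

definition plus_star_word :: "'a star_word \<Rightarrow> 'a star_word \<Rightarrow> 'a star_word" where
  "x + y = Word (letters x @ letters y)"

instance
  by standard (simp_all add: zero_star_word_def plus_star_word_def)

end

type_synonym 'g free_elem = "'g star_word \<Rightarrow>\<^sub>0 complex"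

definition word_star :: "'g star_word \<Rightarrow> 'g star_word" where
  "word_star x = Word (rev (map (\<lambda>(g, b). (g, \<not> b)) (letters x)))"

definition free_star :: "'g free_elem \<Rightarrow> 'g free_elem" where
  "free_star a = (\<Sum>x\<in>Poly_Mapping.keys a. Poly_Mapping.single (word_star x) (cnj (Poly_Mapping.lookup a x)))"

definition free_scale :: "complex \<Rightarrow> 'g free_elem \<Rightarrow> 'g free_elem" where
  "free_scale c a = Poly_Mapping.map (\<lambda>z. c * z) a"

definition free_gen :: "'g \<Rightarrow> 'g free_elem" where
  "free_gen g = Poly_Mapping.single (Word [(g, False)]) 1"

text \<open>
  The free (non-unital) *-algebra on a set \<open>G\<close> of generators: no empty word occurs.
  C*-algebras are not assumed to be unital.
\<close>

definition free_star_alg :: "'g set \<Rightarrow> 'g free_elem set" where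
  "free_star_alg G =
     {a. \<forall>x\<in>Poly_Mapping.keys a. letters x \<noteq> [] \<and> fst ` set (letters x) \<subseteq> G}"

definition cstar_seminorm :: "'g set \<Rightarrow> ('g free_elem \<Rightarrow> real) \<Rightarrow> bool" where
  "cstar_seminorm G p \<longleftrightarrow>
     (\<forall>a\<in>free_star_alg G. 0 \<le> p a) \<and>
     (\<forall>a\<in>free_star_alg G. \<forall>b\<in>free_star_alg G. p (a + b) \<le> p a + p b) \<and>
     (\<forall>c. \<forall>a\<in>free_star_alg G. p (free_scale c a) = cmod c * p a) \<and>
     (\<forall>a\<in>free_star_alg G. \<forall>b\<in>free_star_alg G. p (a * b) \<le> p a * p b) \<and>
     (\<forall>a\<in>free_star_alg G. p (free_star a * a) = (p a)\<^sup>2)"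

text \<open>
  The universal C*-algebra on generators \<open>G\<close> and relations \<open>r = 0\<close>, \<open>r \<in> R\<close>, is the Hausdorff
  completion of the free *-algebra with respect to the largest C*-seminorm that vanishes
  on \<open>R\<close>. As \<^const>\<open>Sup\<close> on the reals requires boundedness, this is meaningful only
  if these seminorms are pointwise bounded, which is the case whenever the relations bound the
  norm of each generator (as the ones of graph C*-algebras do: each generator is a
  partial isometry). Elements are classes of Cauchy sequences modulo null sequences.
\<close>

definition univ_seminorm :: "'g set \<Rightarrow> 'g free_elem set \<Rightarrow> 'g free_elem \<Rightarrow> real" where
  "univ_seminorm G R a = Sup {p a | p. cstar_seminorm G p \<and> (\<forall>r\<in>R. p r = 0)}"

definition univ_Cauchy :: "'g set \<Rightarrow> 'g free_elem set \<Rightarrow> (nat \<Rightarrow> 'g free_elem) set" where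
  "univ_Cauchy G R =
     {X. range X \<subseteq> free_star_alg G \<and>
         (\<forall>\<epsilon>>0. \<exists>N. \<forall>m\<ge>N. \<forall>n\<ge>N. univ_seminorm G R (X m - X n) < \<epsilon>)}"

definition univ_rel ::
  "'g set \<Rightarrow> 'g free_elem set \<Rightarrow> ((nat \<Rightarrow> 'g free_elem) \<times> (nat \<Rightarrow> 'g free_elem)) set" where
  "univ_rel G R =
     {(X, Y). X \<in> univ_Cauchy G R \<and> Y \<in> univ_Cauchy G R \<and>
              (\<lambda>n. univ_seminorm G R (X n - Y n)) \<longlonglongrightarrow> 0}"

type_synonym 'g univ_elem = "(nat \<Rightarrow> 'g free_elem) set"

definition univ_class :: "'g set \<Rightarrow> 'g free_elem set \<Rightarrow> (nat \<Rightarrow> 'g free_elem) \<Rightarrow> 'g univ_elem" where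
  "univ_class G R X = univ_rel G R `` {X}"

text \<open>
  The unions below are the usual choice-free way of applying an operation to representatives:
  all members of the union are the same class.
\<close>

definition univ_cstar :: "'g set \<Rightarrow> 'g free_elem set \<Rightarrow> 'g univ_elem star_algebra" where
  "univ_cstar G R =
     \<lparr>sa_carrier = univ_Cauchy G R // univ_rel G R,
      sa_zero = univ_class G R (\<lambda>n. 0),
      sa_add = (\<lambda>A B. \<Union>X\<in>A. \<Union>Y\<in>B. univ_class G R (\<lambda>n. X n + Y n)),
      sa_scale = (\<lambda>c A. \<Union>X\<in>A. univ_class G R (\<lambda>n. free_scale c (X n))),
      sa_mult = (\<lambda>A B. \<Union>X\<in>A. \<Union>Y\<in>B. univ_class G R (\<lambda>n. X n * Y n)),
      sa_star = (\<lambda>A. \<Union>X\<in>A. univ_class G R (\<lambda>n. free_star (X n))),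
      sa_norm = (\<lambda>A. the_elem ((\<lambda>X. lim (\<lambda>n. univ_seminorm G R (X n))) ` A))\<rparr>"

definition univ_gen :: "'g set \<Rightarrow> 'g free_elem set \<Rightarrow> 'g \<Rightarrow> 'g univ_elem" where
  "univ_gen G R g = univ_class G R (\<lambda>n. free_gen g)"


section \<open>Graphs and paths\<close>

text \<open>
  A graph is a \<^locale>\<open>wf_digraph\<close>: arbitrary sets of vertices and of arcs, where the arc \<open>e\<close>
  has source \<^term>\<open>tail E e\<close> and target \<^term>\<open>head E e\<close>.
\<close>

definition reg :: "('v, 'e) pre_digraph \<Rightarrow> 'v set" where
  "reg E = {v \<in> verts E. finite (out_arcs E v) \<and> out_arcs E v \<noteq> {}}"

text \<open>
  A finite path is given by its source and the list of its edges; the vertex \<open>v\<close>, as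
  a path of length \<open>0\<close>, is \<open>(v, [])\<close>.
\<close>

type_synonym ('v, 'e) path = "'v \<times> 'e list"

definition FP :: "('v, 'e) pre_digraph \<Rightarrow> ('v, 'e) path set" where
  "FP E = {(u, p). \<exists>v. pre_digraph.awalk E u p v}"

definition path_target :: "('v, 'e) pre_digraph \<Rightarrow> ('v, 'e) path \<Rightarrow> 'v" where
  "path_target E \<alpha> = pre_digraph.awlast E (fst \<alpha>) (snd \<alpha>)"

definition vertex_path :: "'v \<Rightarrow> ('v, 'e) path" where
  "vertex_path v = (v, [])"

definition edge_path :: "('v, 'e) pre_digraph \<Rightarrow> 'e \<Rightarrow> ('v, 'e) path" where
  "edge_path E e = (tail E e, [e])"

definition path_concat :: "('v, 'e) path \<Rightarrow> ('v, 'e) path \<Rightarrow> ('v, 'e) path" where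
  "path_concat \<alpha> \<beta> = (fst \<alpha>, snd \<alpha> @ snd \<beta>)"

text \<open>
  The shift of \<open>E\<close>. The new edge is \<^const>\<open>None\<close>; the edges of \<open>E\<close> are tagged by \<^const>\<open>Some\<close>.
\<close>

definition shift ::
  "('v, 'e) pre_digraph \<Rightarrow> 'v \<Rightarrow> 'v \<Rightarrow> ('e \<Rightarrow> 'e) \<Rightarrow> ('v, 'e option) pre_digraph" where
  "shift E v w \<theta> =
     \<lparr>verts = verts E,
      arcs = insert None (Some ` (arcs E - \<theta> ` out_arcs E v)),
      tail = (\<lambda>e. case e of None \<Rightarrow> w | Some e' \<Rightarrow> tail E e'),
      head = (\<lambda>e. case e of None \<Rightarrow> v | Some e' \<Rightarrow> head E e')\<rparr>"


section \<open>Graph inverse semigroups and extended path homomorphisms\<close>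

datatype ('v, 'e) gis_elem = GZero | GPair "('v, 'e) path" "('v, 'e) path"

definition gis :: "('v, 'e) pre_digraph \<Rightarrow> ('v, 'e) gis_elem set" where
  "gis E = insert GZero
     {GPair \<alpha> \<beta> | \<alpha> \<beta>. \<alpha> \<in> FP E \<and> \<beta> \<in> FP E \<and> path_target E \<alpha> = path_target E \<beta>}"

text \<open>
  For paths, \<open>\<gamma> = \<beta>\<gamma>'\<close> for some path \<open>\<gamma>'\<close> iff \<open>\<beta>\<close> and \<open>\<gamma>\<close> have the same source and the edge list
  of \<open>\<beta>\<close> is a prefix of that of \<open>\<gamma>\<close>; then \<open>\<gamma>'\<close> starts at the target of \<open>\<beta>\<close>, and its edges are the
  remaining ones.
\<close>

definition is_prefix :: "('v, 'e) path \<Rightarrow> ('v, 'e) path \<Rightarrow> bool" where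
  "is_prefix \<beta> \<gamma> \<longleftrightarrow> fst \<beta> = fst \<gamma> \<and> prefix (snd \<beta>) (snd \<gamma>)"

definition path_rest :: "('v, 'e) pre_digraph \<Rightarrow> ('v, 'e) path \<Rightarrow> ('v, 'e) path \<Rightarrow> ('v, 'e) path" where
  "path_rest E \<beta> \<gamma> = (path_target E \<beta>, drop (length (snd \<beta>)) (snd \<gamma>))"

fun gis_mult ::
  "('v, 'e) pre_digraph \<Rightarrow> ('v, 'e) gis_elem \<Rightarrow> ('v, 'e) gis_elem \<Rightarrow> ('v, 'e) gis_elem" where
  "gis_mult E (GPair \<alpha> \<beta>) (GPair \<gamma> \<delta>) =
     (if is_prefix \<beta> \<gamma> then GPair (path_concat \<alpha> (path_rest E \<beta> \<gamma>)) \<delta>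
      else if is_prefix \<gamma> \<beta> then GPair \<alpha> (path_concat \<delta> (path_rest E \<gamma> \<beta>))
      else GZero)"
| "gis_mult E GZero t = GZero"
| "gis_mult E s GZero = GZero"

fun gis_star :: "('v, 'e) gis_elem \<Rightarrow> ('v, 'e) gis_elem" where
  "gis_star (GPair \<alpha> \<beta>) = GPair \<beta> \<alpha>"
| "gis_star GZero = GZero"

definition gis_le ::
  "('v, 'e) pre_digraph \<Rightarrow> ('v, 'e) gis_elem \<Rightarrow> ('v, 'e) gis_elem \<Rightarrow> bool" where
  "gis_le E s t \<longleftrightarrow> gis_mult E (gis_mult E s (gis_star s)) t = s"

definition vertex_idem :: "'v \<Rightarrow> ('v, 'e) gis_elem" where
  "vertex_idem v = GPair (vertex_path v) (vertex_path v)"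

definition edge_idem :: "('v, 'e) pre_digraph \<Rightarrow> 'e \<Rightarrow> ('v, 'e) gis_elem" where
  "edge_idem E e = GPair (edge_path E e) (edge_path E e)"

definition edge_elem :: "('v, 'e) pre_digraph \<Rightarrow> 'e \<Rightarrow> ('v, 'e) gis_elem" where
  "edge_elem E e = GPair (edge_path E e) (vertex_path (head E e))"

definition ext_path_hom ::
  "('v, 'e) pre_digraph \<Rightarrow> ('w, 'f) pre_digraph \<Rightarrow>
   (('v, 'e) gis_elem \<Rightarrow> ('w, 'f) gis_elem) \<Rightarrow> bool" where
  "ext_path_hom E F \<phi> \<longleftrightarrow>
     \<phi> \<in> gis E \<rightarrow> gis F \<and>
     (\<forall>s\<in>gis E. \<forall>t\<in>gis E. \<phi> (gis_mult E s t) = gis_mult F (\<phi> s) (\<phi> t)) \<and>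
     \<phi> GZero = GZero"

definition has_values ::
  "('v, 'e) pre_digraph \<Rightarrow> ('v \<Rightarrow> ('w, 'f) gis_elem) \<Rightarrow> ('e \<Rightarrow> ('w, 'f) gis_elem) \<Rightarrow>
   (('v, 'e) gis_elem \<Rightarrow> ('w, 'f) gis_elem) \<Rightarrow> bool" where
  "has_values E \<phi>0 \<phi>1 \<phi> \<longleftrightarrow>
     (\<forall>u\<in>verts E. \<phi> (vertex_idem u) = \<phi>0 u) \<and>
     (\<forall>e\<in>arcs E. \<phi> (edge_elem E e) = \<phi>1 e)"

text \<open>
  Uniqueness is on the carrier \<^term>\<open>gis E\<close> only; the values of \<open>\<phi>\<close> elsewhere are irrelevant.
\<close>

definition determines ::
  "('v, 'e) pre_digraph \<Rightarrow> ('w, 'f) pre_digraph \<Rightarrow>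
   ('v \<Rightarrow> ('w, 'f) gis_elem) \<Rightarrow> ('e \<Rightarrow> ('w, 'f) gis_elem) \<Rightarrow>
   (('v, 'e) gis_elem \<Rightarrow> ('w, 'f) gis_elem) \<Rightarrow> bool" where
  "determines E F \<phi>0 \<phi>1 \<phi> \<longleftrightarrow>
     ext_path_hom E F \<phi> \<and> has_values E \<phi>0 \<phi>1 \<phi> \<and>
     (\<forall>\<psi>. ext_path_hom E F \<psi> \<and> has_values E \<phi>0 \<phi>1 \<psi> \<longrightarrow> (\<forall>s\<in>gis E. \<psi> s = \<phi> s))"

definition regular_hom ::
  "('v, 'e) pre_digraph \<Rightarrow> ('w, 'f) pre_digraph \<Rightarrow>
   (('v, 'e) gis_elem \<Rightarrow> ('w, 'f) gis_elem) \<Rightarrow> bool" where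
  "regular_hom E F \<phi> \<longleftrightarrow>
     (\<forall>u\<in>reg E. \<forall>t\<in>gis F. t \<noteq> GZero \<and> gis_le F t (\<phi> (vertex_idem u)) \<longrightarrow>
        (\<exists>e\<in>out_arcs E u. gis_mult F t (\<phi> (edge_idem E e)) \<noteq> GZero))"


section \<open>Graph C*-algebras\<close>

abbreviation vgen :: "'v \<Rightarrow> ('v + 'e) free_elem" where
  "vgen u \<equiv> free_gen (Inl u)"

abbreviation egen :: "'e \<Rightarrow> ('v + 'e) free_elem" where
  "egen e \<equiv> free_gen (Inr e)"

definition graph_gens :: "('v, 'e) pre_digraph \<Rightarrow> ('v + 'e) set" where
  "graph_gens E = Inl ` verts E \<union> Inr ` arcs E"

definition graph_rels :: "('v, 'e) pre_digraph \<Rightarrow> ('v + 'e) free_elem set" where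
  "graph_rels E =
     {free_star (vgen u) - vgen u | u. u \<in> verts E} \<union>
     {vgen u * vgen u - vgen u | u. u \<in> verts E} \<union>
     {vgen u * vgen u' | u u'. u \<in> verts E \<and> u' \<in> verts E \<and> u \<noteq> u'} \<union>
     {free_star (egen e) * egen e - vgen (head E e) | e. e \<in> arcs E} \<union>
     {free_star (egen e) * egen e' | e e'. e \<in> arcs E \<and> e' \<in> arcs E \<and> e \<noteq> e'} \<union>
     {vgen (tail E e) * egen e - egen e | e. e \<in> arcs E} \<union>
     {vgen u - (\<Sum>e\<in>out_arcs E u. egen e * free_star (egen e)) | u. u \<in> reg E}"

definition graph_cstar :: "('v, 'e) pre_digraph \<Rightarrow> ('v + 'e) univ_elem star_algebra" where
  "graph_cstar E = univ_cstar (graph_gens E) (graph_rels E)"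

definition S_vertex :: "('v, 'e) pre_digraph \<Rightarrow> 'v \<Rightarrow> ('v + 'e) univ_elem" where
  "S_vertex E u = univ_gen (graph_gens E) (graph_rels E) (Inl u)"

definition S_edge :: "('v, 'e) pre_digraph \<Rightarrow> 'e \<Rightarrow> ('v + 'e) univ_elem" where
  "S_edge E e = univ_gen (graph_gens E) (graph_rels E) (Inr e)"

fun S_path :: "('v, 'e) pre_digraph \<Rightarrow> ('v, 'e) path \<Rightarrow> ('v + 'e) univ_elem" where
  "S_path E (u, []) = S_vertex E u"
| "S_path E (u, [e]) = S_edge E e"
| "S_path E (u, e # e' # p) = sa_mult (graph_cstar E) (S_edge E e) (S_path E (tail E e', e' # p))"

fun S_gis :: "('v, 'e) pre_digraph \<Rightarrow> ('v, 'e) gis_elem \<Rightarrow> ('v + 'e) univ_elem" where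
  "S_gis E (GPair \<alpha> \<beta>) =
     sa_mult (graph_cstar E) (S_path E \<alpha>) (sa_star (graph_cstar E) (S_path E \<beta>))"
| "S_gis E GZero = sa_zero (graph_cstar E)"

text \<open>
  \<open>\<phi>\<^sub>*\<close>: the *-homomorphism with the prescribed values on the generators. Functions between
  carriers are normalised to be \<^const>\<open>undefined\<close> outside the carrier of the domain.
\<close>

definition induced_hom ::
  "('v, 'e) pre_digraph \<Rightarrow> ('w, 'f) pre_digraph \<Rightarrow>
   (('v, 'e) gis_elem \<Rightarrow> ('w, 'f) gis_elem) \<Rightarrow>
   ('v + 'e) univ_elem \<Rightarrow> ('w + 'f) univ_elem" where
  "induced_hom E F \<phi> =
     (THE h. h \<in> extensional (sa_carrier (graph_cstar E)) \<and>
             star_hom (graph_cstar E) (graph_cstar F) h \<and>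
             (\<forall>u\<in>verts E. h (S_vertex E u) = S_gis F (\<phi> (vertex_idem u))) \<and>
             (\<forall>e\<in>arcs E. h (S_edge E e) = S_gis F (\<phi> (edge_elem E e))))"

definition inverse_hom ::
  "('a, 'm) star_algebra_scheme \<Rightarrow> ('b, 'n) star_algebra_scheme \<Rightarrow> ('a \<Rightarrow> 'b) \<Rightarrow> 'b \<Rightarrow> 'a" where
  "inverse_hom A B f = restrict (inv_into (sa_carrier A) f) (sa_carrier B)"

end

theory Submission
  imports Defs "HOL-Library.Function_Algebras"
begin

text \<open>
  On paths, \<open>\<phi>\<close> is explicit: replace \<open>x\<^bsub>w,v\<^esub>\<close> by \<open>\<theta>(y)\<close>, cancelling the \<open>y\<close> that follows, and append \<open>y\<close>
  to a path that ends at \<open>v\<close>. As \<open>y\<close> is the only edge leaving \<open>v\<close>, this respects prefixes and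
  incomparability, so that \<open>(\<alpha>, \<beta>) \<mapsto> (\<phi>(\<alpha>), \<phi>(\<beta>))\<close> is multiplicative. It is the only homomorphism with
  the given values because inverses in a graph inverse semigroup are unique.

  That \<open>\<phi>\<^sub>*\<close> inverts \<open>f\<^sub>*\<close> is a comparison on generators, by the graph relations. It suffices because
  *-homomorphisms of C*-algebras are automatically contractive: for self-adjoint \<open>x\<close> of norm
  less than \<open>1\<close>, the element \<open>u = sqrt (1 - x\<^sup>2) + \<i>x\<close> is unitary, which is an algebraic identity and hence
  also holds for the images; then \<open>x = (u - u\<^sup>*) / 2\<i>\<close> shows that the image of \<open>x\<close> has norm at most \<open>1\<close>.
  The root is obtained by iteration, on representatives.

  The case \<open>v = w\<close> is void: then \<open>\<theta>(y) = y\<close> is not an edge of the shift, so that the class denoted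
  by \<open>S\<^sub>y\<close> there is empty, and \<open>f\<close> would take a value outside the carrier.
\<close>

subsection \<open>C*-seminorms on concrete *-algebras\<close>

text \<open>Only closure is relative to \<open>C\<close>; the identities hold in the whole ring. So
  the locale fits both the free *-algebra and the *-algebra of Cauchy sequences in it.\<close>

locale star_algebra_on =
  fixes C :: "'a::ring set" and st :: "'a \<Rightarrow> 'a" and sc :: "complex \<Rightarrow> 'a \<Rightarrow> 'a"
  assumes zero_mem: "0 \<in> C"
    and add_mem: "a \<in> C \<Longrightarrow> b \<in> C \<Longrightarrow> a + b \<in> C"
    and mult_mem: "a \<in> C \<Longrightarrow> b \<in> C \<Longrightarrow> a * b \<in> C"
    and st_mem: "a \<in> C \<Longrightarrow> st a \<in> C"
    and sc_mem: "a \<in> C \<Longrightarrow> sc c a \<in> C"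
    and st_add: "st (a + b) = st a + st b"
    and st_mult: "st (a * b) = st b * st a"
    and st_st: "st (st a) = a"
    and st_sc: "st (sc c a) = sc (cnj c) (st a)"
    and sc_add: "sc c (a + b) = sc c a + sc c b"
    and sc_add_left: "sc (c + d) a = sc c a + sc d a"
    and sc_sc: "sc c (sc d a) = sc (c * d) a"
    and sc_mult_left: "sc c a * b = sc c (a * b)"
    and sc_mult_right: "a * sc c b = sc c (a * b)"
    and sc_one: "sc 1 a = a"
begin

lemma sc_zero_left: "sc 0 a = 0"
  using sc_add_left[of 0 0 a] by simp

lemma sc_minus_left: "sc (- c) a = - sc c a"
  using sc_add_left[of c "- c" a] by (simp add: sc_zero_left add_eq_0_iff)

lemma sc_zero: "sc c 0 = 0"
  using sc_add[of c 0 0] by simp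

lemma sc_minus: "sc c (- a) = - sc c a"
  using sc_add[of c a "- a"] by (simp add: sc_zero add_eq_0_iff)

lemma sc_diff: "sc c (a - b) = sc c a - sc c b"
  using sc_add[of c a "- b"] by (simp add: sc_minus)

lemma minus_mem: "a \<in> C \<Longrightarrow> - a \<in> C"
  using sc_mem[of a "-1"] by (simp add: sc_minus_left sc_one)

lemma diff_mem: "a \<in> C \<Longrightarrow> b \<in> C \<Longrightarrow> a - b \<in> C"
  using add_mem[of a "- b"] minus_mem by simp

lemma st_zero: "st 0 = 0"
  using st_add[of 0 0] by simp

lemma st_minus: "st (- a) = - st a"
  using st_add[of a "- a"] by (simp add: st_zero add_eq_0_iff)

lemma st_diff: "st (a - b) = st a - st b"
  using st_add[of a "- b"] by (simp add: st_minus)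

lemmas mem = zero_mem add_mem mult_mem st_mem sc_mem minus_mem diff_mem

end

locale cstar_seminorm_on = star_algebra_on C st sc
  for C :: "'a::ring set" and st sc +
  fixes p :: "'a \<Rightarrow> real"
  assumes nonneg: "a \<in> C \<Longrightarrow> 0 \<le> p a"
    and triangle: "a \<in> C \<Longrightarrow> b \<in> C \<Longrightarrow> p (a + b) \<le> p a + p b"
    and scale: "a \<in> C \<Longrightarrow> p (sc c a) = cmod c * p a"
    and submult: "a \<in> C \<Longrightarrow> b \<in> C \<Longrightarrow> p (a * b) \<le> p a * p b"
    and cstar: "a \<in> C \<Longrightarrow> p (st a * a) = (p a)\<^sup>2"
begin

lemma p_zero: "p 0 = 0"
  using scale[OF zero_mem, of 0] by (simp add: sc_zero)

lemma p_minus: "a \<in> C \<Longrightarrow> p (- a) = p a"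
  using scale[of a "-1"] by (simp add: sc_minus_left sc_one)

lemma triangle_diff: "a \<in> C \<Longrightarrow> b \<in> C \<Longrightarrow> p (a - b) \<le> p a + p b"
  using triangle[of a "- b"] p_minus minus_mem by simp

lemma p_diff_commute: "a \<in> C \<Longrightarrow> b \<in> C \<Longrightarrow> p (a - b) = p (b - a)"
  using p_minus[of "a - b"] by (simp add: mem)

lemma triangle_via:
  assumes "a \<in> C" "b \<in> C" "c \<in> C"
  shows "p (a - c) \<le> p (a - b) + p (b - c)"
  using triangle[of "a - b" "b - c"] assms by (simp add: mem)

lemma p_diff_ge:
  assumes "a \<in> C" "b \<in> C"
  shows "\<bar>p a - p b\<bar> \<le> p (a - b)"
  using triangle[of "a - b" b] triangle[of "b - a" a] p_diff_commute[of a b] assms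
  by (simp add: mem)

lemma p_eq_if_null:
  assumes "a \<in> C" "b \<in> C" "p (a - b) = 0"
  shows "p a = p b"
  using p_diff_ge[OF assms(1,2)] assms(3) by simp

lemma null_mult_left: "a \<in> C \<Longrightarrow> b \<in> C \<Longrightarrow> p a = 0 \<Longrightarrow> p (a * b) = 0"
  using submult[of a b] nonneg[of "a * b"] by (simp add: mem)

lemma null_mult_right: "a \<in> C \<Longrightarrow> b \<in> C \<Longrightarrow> p b = 0 \<Longrightarrow> p (a * b) = 0"
  using submult[of a b] nonneg[of "a * b"] by (simp add: mem)

lemma null_add: "a \<in> C \<Longrightarrow> b \<in> C \<Longrightarrow> p a = 0 \<Longrightarrow> p b = 0 \<Longrightarrow> p (a + b) = 0"
  using triangle[of a b] nonneg[of "a + b"] by (simp add: mem)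

lemma null_trans:
  assumes "a \<in> C" "b \<in> C" "c \<in> C" "p (a - b) = 0" "p (b - c) = 0"
  shows "p (a - c) = 0"
  using triangle_via[OF assms(1-3)] assms nonneg[of "a - c"] by (simp add: mem)

text \<open>The C*-identity and submultiplicativity give
  \<open>p b * p b \<le> p (st b) * p b\<close>; cancel \<open>p b\<close>, then use the same bound
  for \<open>st b\<close>.\<close>

lemma p_star: 
  assumes "a \<in> C"
  shows "p (st a) = p a"
proof -
  have le: "p b \<le> p (st b)" if b: "b \<in> C" for b
  proof (cases "p b = 0")
    case True
    then show ?thesis using nonneg[of "st b"] b by (simp add: mem)
  next
    case False
    then have pos: "0 < p b" using nonneg[OF b] by simp
    have "p b * p b \<le> p (st b) * p b"
      using cstar[OF b] submult[of "st b" b] b by (simp add: mem power2_eq_square)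
    then show ?thesis using pos by simp
  qed
  show ?thesis
    using le[OF assms] le[of "st a"] assms by (simp add: mem st_st)
qed

lemma p_mult_diff:
  assumes "a \<in> C" "b \<in> C" "a' \<in> C" "b' \<in> C"
  shows "p (a * b - a' * b') \<le> p a * p (b - b') + p (a - a') * p b'"
proof -
  have "a * b - a' * b' = a * (b - b') + (a - a') * b'"
    by (simp add: algebra_simps)
  then have "p (a * b - a' * b') \<le> p (a * (b - b')) + p ((a - a') * b')"
    using triangle[of "a * (b - b')" "(a - a') * b'"] assms by (simp add: mem)
  also have "\<dots> \<le> p a * p (b - b') + p (a - a') * p b'"
    using submult[of a "b - b'"] submult[of "a - a'" b'] assms by (simp add: mem)
  finally show ?thesis .
qed

text \<open>With a formal unit, \<open>null\<close> says that \<open>u = 1 + w\<close> satisfies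
  \<open>st u * u = 1\<close> up to a null element. So \<open>st ?c * ?c\<close> and
  \<open>st b * b\<close> differ by a null element, and the C*-identity compares the
  seminorms.\<close>

lemma isometry_if_unitary:
  assumes "w \<in> C" "b \<in> C" and null: "p (w + st w + st w * w) = 0"
  shows "p (b + w * b) = p b"
proof -
  let ?c = "b + w * b"
  have eq: "st ?c * ?c - st b * b = st b * ((w + st w + st w * w) * b)"
    by (simp add: st_add st_mult algebra_simps)
  have "p (st ?c * ?c - st b * b) = 0"
    unfolding eq
    by (intro null_mult_right[OF _ _ null_mult_left[OF _ _ null]] mem assms)
  then have "p (st ?c * ?c) = p (st b * b)"
    by (intro p_eq_if_null mem assms)
  moreover have c: "?c \<in> C"
    by (intro mem assms)
  ultimately have "(p ?c)\<^sup>2 = (p b)\<^sup>2"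
    using cstar[of ?c] cstar[of b] assms(2) by metis
  then show ?thesis
    using nonneg[of ?c] nonneg[of b] c assms(2) by simp
qed

text \<open>
  Formally \<open>1 - r = sqrt (1 - x\<^sup>2)\<close>, so that \<open>u = 1 - r + \<i>x\<close> is unitary and \<open>2\<i>x = u - u\<^sup>*\<close>.
  No unit is needed: only multiplication by \<open>u\<close> occurs.
\<close>

lemma le_one_if_sqrt:
  assumes x: "x \<in> C" "st x = x" and r: "r \<in> C" "st r = r"
    and comm: "x * r = r * x" and null: "p (r + r - r * r - x * x) = 0"
  shows "p x \<le> 1"
proof -
  \<comment> \<open>\<open>w\<close> stands for \<open>u - 1\<close>.\<close>
  define w where "w = sc \<i> x - r"
  have w: "w \<in> C" "st w \<in> C"
    using x r by (simp_all add: w_def mem)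
  have stw: "st w = - sc \<i> x - r"
    using x r by (simp add: w_def st_diff st_sc sc_minus_left)
  have "st w * w = r * r + x * x" "w * st w = r * r + x * x"
    unfolding stw unfolding w_def
    by (simp_all add: algebra_simps sc_mult_left sc_mult_right sc_sc sc_minus_left sc_one sc_add
        sc_minus sc_diff comm)
  \<comment> \<open>The unitarity defects of \<open>u\<close> and of \<open>st u\<close> are both
    the negative of the defect of the root equation, so both multiplications are isometric.\<close>
  then have s: "w + st w + st w * w = - (r + r - r * r - x * x)"
    "st w + w + w * st w = - (r + r - r * r - x * x)"
    unfolding stw by (simp_all add: w_def algebra_simps)
  have null': "p (- (r + r - r * r - x * x)) = 0"
    using null x r by (subst p_minus) (simp_all add: mem)
  have iso: "p (x + w * x) = p x" "p (x + st w * x) = p x"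
    using isometry_if_unitary[of w x] isometry_if_unitary[of "st w" x] w x s null'
    by (simp_all add: st_st)
  \<comment> \<open>This is \<open>2 \<i> x = u - st u\<close> multiplied by \<open>x\<close>, since
    isometry is a statement about products \<open>u b\<close>.\<close>
  have "sc (2 * \<i>) (x * x) = (x + w * x) - (x + st w * x)"
    unfolding stw unfolding w_def
    using sc_add_left[of \<i> \<i> "x * x"] by (simp add: algebra_simps sc_mult_left)
  then have "p (sc (2 * \<i>) (x * x)) \<le> p x + p x"
    using triangle_diff[of "x + w * x" "x + st w * x"] x w iso by (simp add: mem)
  then have "p x * p x \<le> p x"
    using scale[of "x * x" "2 * \<i>"] cstar[of x] x by (simp add: mem norm_mult power2_eq_square)
  then have "p x * p x \<le> 1 * p x"
    by simp
  then show ?thesis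
    using nonneg[OF x(1)] mult_le_cancel_right by fastforce
qed

end

subsection \<open>The free *-algebra\<close>

lemma word_star_word_star [simp]: "word_star (word_star x) = x"
  by (cases x) (simp add: word_star_def rev_map comp_def case_prod_beta)

lemma word_star_plus: "word_star (x + y) = word_star y + word_star x"
  by (simp add: word_star_def plus_star_word_def)

lemma letters_word_star: "letters (word_star x) = rev (map (\<lambda>(g, b). (g, \<not> b)) (letters x))"
  by (simp add: word_star_def)

lemma lookup_free_star: "Poly_Mapping.lookup (free_star a) x = cnj (Poly_Mapping.lookup a (word_star x))"
proof -
  have "Poly_Mapping.lookup (free_star a) x =
    (\<Sum>z\<in>Poly_Mapping.keys a. if z = word_star x then cnj (Poly_Mapping.lookup a z) else 0)"
    unfolding free_star_def lookup_sum
    by (intro sum.cong) (auto simp: lookup_single when_def)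
  also have "\<dots> = cnj (Poly_Mapping.lookup a (word_star x))"
    by (auto simp: in_keys_iff)
  finally show ?thesis .
qed

text \<open>Scaling is convolution with a multiple of the empty word, so its laws reduce to ring
  laws and \<open>single_zero_commute\<close>.\<close>

lemma free_scale_eq_mult: "free_scale c a = Poly_Mapping.single 0 c * a"
  by (simp add: free_scale_def mult_map_scale_conv_mult)

lemma lookup_free_scale: "Poly_Mapping.lookup (free_scale c a) x = c * Poly_Mapping.lookup a x"
  by (simp add: free_scale_def Poly_Mapping.map.rep_eq when_def)

lemma free_star_single: "free_star (Poly_Mapping.single x c) = Poly_Mapping.single (word_star x) (cnj c)"
  by (rule poly_mapping_eqI) (auto simp: lookup_free_star lookup_single when_def)

lemma free_star_zero: "free_star 0 = 0"
  by (rule poly_mapping_eqI) (simp add: lookup_free_star)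

lemma free_star_add: "free_star (a + b) = free_star a + free_star b"
  by (rule poly_mapping_eqI) (simp add: lookup_free_star lookup_add)

text \<open>Reduces additive identities to monomials. That \<open>x\<close> is a fresh key rules out
  cancellation, which lets \<open>free_star_alg_induct\<close> pass membership on to the
  summands.\<close>

lemma poly_mapping_single_induct [case_names zero add]:
  assumes "P 0"
    and "\<And>a x c. P a \<Longrightarrow> x \<notin> Poly_Mapping.keys a \<Longrightarrow> c \<noteq> 0 \<Longrightarrow> P (Poly_Mapping.single x c + a)"
  shows "P a"
proof (induction a rule: update_induct)
  case const
  then show ?case by (rule assms(1))
next
  case (update f a b)
  have "Poly_Mapping.update a b f = Poly_Mapping.single a b + f"
    using update.hyps
    by (intro poly_mapping_eqI) (auto simp: lookup_update lookup_add lookup_single when_def in_keys_iff)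
  then show ?case using assms(2)[OF update.IH, of a b] update.hyps by simp
qed

lemma free_star_mult: "free_star (a * b) = free_star b * free_star a"
proof (induction a rule: poly_mapping_single_induct)
  case zero
  then show ?case by (simp add: free_star_zero)
next
  case (add a x c)
  have "free_star (Poly_Mapping.single x c * b) = free_star b * free_star (Poly_Mapping.single x c)"
  proof (induction b rule: poly_mapping_single_induct)
    case zero
    then show ?case by (simp add: free_star_zero)
  next
    case (add b z d)
    then show ?case
      by (simp add: free_star_add distrib_left distrib_right mult_single free_star_single
          word_star_plus mult.commute)
  qed
  then show ?case using add.IH by (simp add: free_star_add distrib_left distrib_right)
qed

lemma single_zero_commute:
  fixes a :: "'g free_elem"
  shows "a * Poly_Mapping.single 0 c = Poly_Mapping.single 0 c * a"
  by (induction a rule: poly_mapping_single_induct)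
    (simp_all add: distrib_left distrib_right mult_single mult.commute)

lemma free_star_alg_iff:
  "a \<in> free_star_alg G \<longleftrightarrow>
    (\<forall>x. Poly_Mapping.lookup a x \<noteq> 0 \<longrightarrow> letters x \<noteq> [] \<and> fst ` set (letters x) \<subseteq> G)"
  by (simp add: free_star_alg_def in_keys_iff Ball_def)

lemma star_algebra_free: "star_algebra_on (free_star_alg G) free_star free_scale"
proof
  fix a b :: "'a free_elem" and c d :: complex
  show "0 \<in> free_star_alg G" by (simp add: free_star_alg_def)
  show "a + b \<in> free_star_alg G" if "a \<in> free_star_alg G" "b \<in> free_star_alg G"
    using that keys_add[of a b] unfolding free_star_alg_def by blast
  show "a * b \<in> free_star_alg G" if "a \<in> free_star_alg G" "b \<in> free_star_alg G"
    using that keys_mult[of a b] unfolding free_star_alg_def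
    by (fastforce simp: plus_star_word_def)
  show "free_star a \<in> free_star_alg G" if "a \<in> free_star_alg G"
    unfolding free_star_alg_iff
  proof (intro allI impI)
    fix x assume "Poly_Mapping.lookup (free_star a) x \<noteq> 0"
    then have "letters (word_star x) \<noteq> [] \<and> fst ` set (letters (word_star x)) \<subseteq> G"
      using that by (auto simp: lookup_free_star free_star_alg_iff)
    then show "letters x \<noteq> [] \<and> fst ` set (letters x) \<subseteq> G"
      by (auto simp: letters_word_star image_image case_prod_beta)
  qed
  show "free_scale c a \<in> free_star_alg G" if "a \<in> free_star_alg G"
    using that by (auto simp: free_star_alg_iff lookup_free_scale)
  show "free_star (a + b) = free_star a + free_star b" by (rule free_star_add)
  show "free_star (a * b) = free_star b * free_star a" by (rule free_star_mult)
  show "free_star (free_star a) = a" by (rule poly_mapping_eqI) (simp add: lookup_free_star)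
  show "free_star (free_scale c a) = free_scale (cnj c) (free_star a)"
    by (rule poly_mapping_eqI) (simp add: lookup_free_star lookup_free_scale)
  show "free_scale c (a + b) = free_scale c a + free_scale c b"
    by (simp add: free_scale_eq_mult distrib_left)
  show "free_scale (c + d) a = free_scale c a + free_scale d a"
    by (simp add: free_scale_eq_mult single_add distrib_right)
  show "free_scale c (free_scale d a) = free_scale (c * d) a"
    by (simp add: free_scale_eq_mult mult.assoc[symmetric] mult_single)
  show "free_scale c a * b = free_scale c (a * b)"
    by (simp add: free_scale_eq_mult mult.assoc)
  show "a * free_scale c b = free_scale c (a * b)"
    by (simp add: free_scale_eq_mult mult.assoc[symmetric] single_zero_commute)
  show "free_scale 1 a = a"
    by (simp add: free_scale_eq_mult)
qed

lemma free_gen_mem: "g \<in> G \<Longrightarrow> free_gen g \<in> free_star_alg G"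
  by (simp add: free_gen_def free_star_alg_def)

lemma cstar_seminorm_iff:
  "cstar_seminorm G p \<longleftrightarrow> cstar_seminorm_on (free_star_alg G) free_star free_scale p"
  unfolding cstar_seminorm_def cstar_seminorm_on_def cstar_seminorm_on_axioms_def
  using star_algebra_free by blast

lemma single_eq_letters:
  fixes g :: 'g
  assumes "xs \<noteq> []"
  shows "Poly_Mapping.single (Word ((g, b) # xs)) 1 =
    (if b then free_star (free_gen g) else free_gen g) * (Poly_Mapping.single (Word xs) 1 :: 'g free_elem)"
  by (simp add: free_gen_def free_star_single mult_single plus_star_word_def word_star_def)

lemma free_star_alg_induct [consumes 1, case_names gen add mult star scale zero]:
  assumes "a \<in> free_star_alg G"
    and gen: "\<And>g. g \<in> G \<Longrightarrow> P (free_gen g)"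
    and add: "\<And>a b. a \<in> free_star_alg G \<Longrightarrow> b \<in> free_star_alg G \<Longrightarrow> P a \<Longrightarrow> P b \<Longrightarrow> P (a + b)"
    and mult: "\<And>a b. a \<in> free_star_alg G \<Longrightarrow> b \<in> free_star_alg G \<Longrightarrow> P a \<Longrightarrow> P b \<Longrightarrow> P (a * b)"
    and star: "\<And>a. a \<in> free_star_alg G \<Longrightarrow> P a \<Longrightarrow> P (free_star a)"
    and scale: "\<And>a c. a \<in> free_star_alg G \<Longrightarrow> P a \<Longrightarrow> P (free_scale c a)"
    and zero: "P 0"
  shows "P a"
proof -
  interpret star_algebra_on "free_star_alg G" free_star free_scale by (rule star_algebra_free)
  \<comment> \<open>The induction starts at one letter, as the empty word lies outside the
    algebra.\<close>
  have word: "P (Poly_Mapping.single (Word xs) 1) \<and> Poly_Mapping.single (Word xs) 1 \<in> free_star_alg G"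
    if "xs \<noteq> []" "fst ` set xs \<subseteq> G" for xs
    using that
  proof (induction xs rule: list_nonempty_induct)
    case (single l)
    obtain g b where l: "l = (g, b)" by fastforce
    have "Poly_Mapping.single (Word [l]) 1 = (if b then free_star (free_gen g) else free_gen g)"
      by (simp add: l free_gen_def free_star_single word_star_def)
    then show ?case using single l by (auto intro!: gen star free_gen_mem mem)
  next
    case (cons l xs)
    obtain g b where l: "l = (g, b)" by fastforce
    have "g \<in> G" "fst ` set xs \<subseteq> G" using cons.prems l by auto
    then show ?case
      using cons l by (auto simp: single_eq_letters intro!: mult gen star free_gen_mem mem)
  qed
  have single: "P (Poly_Mapping.single x c) \<and> Poly_Mapping.single x c \<in> free_star_alg G"
    if "letters x \<noteq> []" "fst ` set (letters x) \<subseteq> G" for x c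
  proof -
    have "Poly_Mapping.single x c = free_scale c (Poly_Mapping.single (Word (letters x)) 1)"
      by (simp add: free_scale_eq_mult mult_single)
    moreover have "P \<dots>" "\<dots> \<in> free_star_alg G"
      using word[of "letters x"] that by (auto intro!: scale sc_mem)
    ultimately show ?thesis by metis
  qed
  show ?thesis
    using assms(1)
  proof (induction a rule: poly_mapping_single_induct)
    case zero
    then show ?case by (simp add: assms(7))
  next
    case (add a x c)
    \<comment> \<open>As \<open>x\<close> is no key of \<open>a\<close>, nothing cancels: every key
      of a summand is a key of the sum.\<close>
    have l: "Poly_Mapping.lookup (Poly_Mapping.single x c + a) z \<noteq> 0"
      if "z = x \<or> Poly_Mapping.lookup a z \<noteq> 0" for z
      using that add.hyps by (auto simp: lookup_add lookup_single when_def in_keys_iff)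
    have "a \<in> free_star_alg G" "letters x \<noteq> []" "fst ` set (letters x) \<subseteq> G"
      using add.prems l unfolding free_star_alg_iff by blast+
    then show ?case using add.IH single assms(3) by blast
  qed
qed

subsection \<open>Universal C*-algebras\<close>

definition seq_star :: "(nat \<Rightarrow> 'g free_elem) \<Rightarrow> nat \<Rightarrow> 'g free_elem" where
  "seq_star X = (\<lambda>n. free_star (X n))"

definition seq_scale :: "complex \<Rightarrow> (nat \<Rightarrow> 'g free_elem) \<Rightarrow> nat \<Rightarrow> 'g free_elem" where
  "seq_scale c X = (\<lambda>n. free_scale c (X n))"

text \<open>\<open>Sup\<close> of an unbounded set of reals is an unspecified value; the assumption
  makes \<open>univ_seminorm\<close> a true supremum.\<close>

locale bounded_relations =
  fixes G :: "'g set" and R :: "'g free_elem set"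
  assumes bounded: "a \<in> free_star_alg G \<Longrightarrow>
    \<exists>M. \<forall>p. cstar_seminorm G p \<and> (\<forall>r\<in>R. p r = 0) \<longrightarrow> p a \<le> M"
begin

abbreviation "A \<equiv> free_star_alg G"
abbreviation "P \<equiv> univ_seminorm G R"
abbreviation "CS \<equiv> univ_Cauchy G R"
abbreviation "U \<equiv> univ_cstar G R"
abbreviation "cls \<equiv> univ_class G R"

sublocale free: star_algebra_on A free_star free_scale
  by (rule star_algebra_free)

section \<open>The universal seminorm as a C*-seminorm\<close>

lemma cstar_seminorm_zero: "cstar_seminorm G (\<lambda>_. 0)"
  by (simp add: cstar_seminorm_def)

lemma P_upper:
  assumes "a \<in> A" "cstar_seminorm G p" "\<forall>r\<in>R. p r = 0"
  shows "p a \<le> P a"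
proof -
  obtain M where "\<forall>p. cstar_seminorm G p \<and> (\<forall>r\<in>R. p r = 0) \<longrightarrow> p a \<le> M"
    using bounded[OF assms(1)] by blast
  then have "bdd_above {p a | p. cstar_seminorm G p \<and> (\<forall>r\<in>R. p r = 0)}"
    unfolding bdd_above_def by blast
  then show ?thesis
    unfolding univ_seminorm_def using assms by (intro cSup_upper) auto
qed

lemma P_least:
  assumes "\<And>p. cstar_seminorm G p \<Longrightarrow> \<forall>r\<in>R. p r = 0 \<Longrightarrow> p a \<le> M"
  shows "P a \<le> M"
  \<comment> \<open>The zero seminorm makes the set nonempty, as \<open>cSup_least\<close>
    requires.\<close>
  unfolding univ_seminorm_def using assms cstar_seminorm_zero by (intro cSup_least) auto

lemma P_nonneg: "a \<in> A \<Longrightarrow> 0 \<le> P a"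
  using P_upper[OF _ cstar_seminorm_zero] by simp

lemma P_rel: "r \<in> R \<Longrightarrow> P r = 0"
proof -
  assume "r \<in> R"
  then have "{p r | p. cstar_seminorm G p \<and> (\<forall>r\<in>R. p r = 0)} = {0}"
    using cstar_seminorm_zero by auto
  then show ?thesis by (simp add: univ_seminorm_def)
qed

text \<open>Each axiom passes to a pointwise supremum; the two equations are split into
  inequalities, so that the seminorms \<open>p\<close> can be bounded one at a time.\<close>

sublocale P: cstar_seminorm_on A free_star free_scale P
proof
  fix a b :: "'g free_elem" and c :: complex
  assume a: "a \<in> A"
  show "0 \<le> P a" using a by (rule P_nonneg)
  show "P (free_scale c a) = cmod c * P a"
  proof (rule antisym)
    show "P (free_scale c a) \<le> cmod c * P a"
    proof (rule P_least)
      fix p assume p: "cstar_seminorm G p" "\<forall>r\<in>R. p r = 0"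
      then have "p (free_scale c a) = cmod c * p a"
        using a by (simp add: cstar_seminorm_def)
      then show "p (free_scale c a) \<le> cmod c * P a"
        using P_upper[OF a p] by (simp add: mult_left_mono)
    qed
    show "cmod c * P a \<le> P (free_scale c a)"
    proof (cases "c = 0")
      case True
      then show ?thesis using P_nonneg[OF free.sc_mem[OF a]] by simp
    next
      case False
      \<comment> \<open>Division leaves \<open>P a\<close> alone on the left, where
        \<open>P_least\<close> applies.\<close>
      have "P a \<le> P (free_scale c a) / cmod c"
      proof (rule P_least)
        fix p assume p: "cstar_seminorm G p" "\<forall>r\<in>R. p r = 0"
        then have "cmod c * p a = p (free_scale c a)"
          using a by (simp add: cstar_seminorm_def)
        then show "p a \<le> P (free_scale c a) / cmod c"
          using P_upper[OF free.sc_mem[OF a] p, of c] False by (simp add: field_simps)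
      qed
      then show ?thesis using False by (simp add: field_simps)
    qed
  qed
  show "P (free_star a * a) = (P a)\<^sup>2"
  proof (rule antisym)
    show "P (free_star a * a) \<le> (P a)\<^sup>2"
    proof (rule P_least)
      fix p assume p: "cstar_seminorm G p" "\<forall>r\<in>R. p r = 0"
      then have "p (free_star a * a) = (p a)\<^sup>2" "0 \<le> p a"
        using a by (simp_all add: cstar_seminorm_def)
      then show "p (free_star a * a) \<le> (P a)\<^sup>2"
        using P_upper[OF a p] by (simp add: power_mono)
    qed
    have m: "free_star a * a \<in> A" using a by (intro free.mem)
    \<comment> \<open>The root isolates \<open>P a\<close> for the same reason.\<close>
    have "P a \<le> sqrt (P (free_star a * a))"
    proof (rule P_least)
      fix p assume p: "cstar_seminorm G p" "\<forall>r\<in>R. p r = 0"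
      then have "(p a)\<^sup>2 = p (free_star a * a)"
        using a by (simp add: cstar_seminorm_def)
      then show "p a \<le> sqrt (P (free_star a * a))"
        using P_upper[OF m p] by (simp add: real_le_rsqrt)
    qed
    then show "(P a)\<^sup>2 \<le> P (free_star a * a)"
      using P_nonneg[OF a] P_nonneg[OF m] by (metis power_mono real_sqrt_pow2)
  qed
  assume b: "b \<in> A"
  show "P (a + b) \<le> P a + P b"
  proof (rule P_least)
    fix p assume p: "cstar_seminorm G p" "\<forall>r\<in>R. p r = 0"
    then have "p (a + b) \<le> p a + p b"
      using a b by (simp add: cstar_seminorm_def)
    then show "p (a + b) \<le> P a + P b"
      using P_upper[OF a p] P_upper[OF b p] by simp
  qed
  show "P (a * b) \<le> P a * P b"
  proof (rule P_least)
    fix p assume p: "cstar_seminorm G p" "\<forall>r\<in>R. p r = 0"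
    then have "p (a * b) \<le> p a * p b" "0 \<le> p a" "0 \<le> p b"
      using a b by (simp_all add: cstar_seminorm_def)
    then show "p (a * b) \<le> P a * P b"
      using P_upper[OF a p] P_upper[OF b p] mult_mono[of "p a" "P a" "p b" "P b"] by simp
  qed
qed

subsubsection \<open>Cauchy sequences\<close>

lemma CS_iff:
  "X \<in> CS \<longleftrightarrow> (\<forall>n. X n \<in> A) \<and> (\<forall>\<epsilon>>0. \<exists>N. \<forall>m\<ge>N. \<forall>n\<ge>N. P (X m - X n) < \<epsilon>)"
  unfolding univ_Cauchy_def by blast

lemma CS_mem: "X \<in> CS \<Longrightarrow> X n \<in> A"
  by (simp add: CS_iff)

lemma CS_E:
  assumes "X \<in> CS" "\<epsilon> > 0"
  obtains N where "\<And>m n. m \<ge> N \<Longrightarrow> n \<ge> N \<Longrightarrow> P (X m - X n) < \<epsilon>"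
  using assms unfolding CS_iff by blast

lemma CS_const: "a \<in> A \<Longrightarrow> (\<lambda>_. a) \<in> CS"
  by (simp add: CS_iff P.p_zero)

text \<open>The norm of the class of \<open>X\<close>, by \<open>norm_cls\<close>, read on
  representatives, where ring arithmetic is available.\<close>

definition q :: "(nat \<Rightarrow> 'g free_elem) \<Rightarrow> real" where
  "q X = lim (\<lambda>n. P (X n))"

lemma q_tendsto:
  assumes X: "X \<in> CS"
  shows "(\<lambda>n. P (X n)) \<longlonglongrightarrow> q X"
proof -
  have "Cauchy (\<lambda>n. P (X n))"
  proof (rule metric_CauchyI)
    fix e :: real assume "0 < e"
    then obtain N where N: "\<And>m n. m \<ge> N \<Longrightarrow> n \<ge> N \<Longrightarrow> P (X m - X n) < e"
      using CS_E[OF X] by blast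
    have "dist (P (X m)) (P (X n)) < e" if "m \<ge> N" "n \<ge> N" for m n
      using P.p_diff_ge[OF CS_mem[OF X] CS_mem[OF X], of m n] N[OF that]
      by (simp add: dist_real_def)
    then show "\<exists>M. \<forall>m\<ge>M. \<forall>n\<ge>M. dist (P (X m)) (P (X n)) < e" by blast
  qed
  then show ?thesis
    unfolding q_def using Cauchy_convergent convergent_LIMSEQ_iff by blast
qed

lemma q_eqI: "(\<lambda>n. P (X n)) \<longlonglongrightarrow> l \<Longrightarrow> q X = l"
  unfolding q_def by (rule limI)

lemma q_const: "q (\<lambda>_. a) = P a"
  by (intro q_eqI tendsto_const)

text \<open>One Cauchy criterion for sum, product, adjoint and scaling: the variation of
  \<open>Z\<close> is controlled linearly by those of \<open>X\<close> and \<open>Y\<close>.\<close>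

lemma CS_I2:
  assumes "X \<in> CS" "Y \<in> CS" "\<And>n. Z n \<in> A" "0 \<le> K" "0 \<le> L"
    and le: "\<And>m n. P (Z m - Z n) \<le> K * P (X m - X n) + L * P (Y m - Y n)"
  shows "Z \<in> CS"
  unfolding CS_iff
proof (intro conjI allI impI)
  fix e :: real assume e: "0 < e"
  \<comment> \<open>The summand \<open>1\<close> keeps the divisor positive and makes the final
    estimate strict.\<close>
  define d where "d = e / (K + L + 1)"
  have d: "0 < d" using e assms by (simp add: d_def)
  obtain M where M: "\<And>m n. m \<ge> M \<Longrightarrow> n \<ge> M \<Longrightarrow> P (X m - X n) < d"
    using CS_E[OF assms(1) d] by blast
  obtain N where N: "\<And>m n. m \<ge> N \<Longrightarrow> n \<ge> N \<Longrightarrow> P (Y m - Y n) < d"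
    using CS_E[OF assms(2) d] by blast
  have "P (Z m - Z n) < e" if "m \<ge> max M N" "n \<ge> max M N" for m n
  proof -
    have "P (Z m - Z n) \<le> K * d + L * d"
      using le[of m n] M[of m n] N[of m n] that assms(4,5)
        mult_left_mono[of "P (X m - X n)" d K] mult_left_mono[of "P (Y m - Y n)" d L]
      by simp
    also have "\<dots> < (K + L + 1) * d" using d by (simp add: algebra_simps)
    also have "\<dots> = e" using assms by (simp add: d_def)
    finally show ?thesis .
  qed
  then show "\<exists>N. \<forall>m\<ge>N. \<forall>n\<ge>N. P (Z m - Z n) < e" by blast
qed (use assms in simp)

lemma CS_bounded:
  assumes "X \<in> CS"
  obtains M where "0 \<le> M" "\<And>n. P (X n) \<le> M"
proof -
  have "Bseq (\<lambda>n. P (X n))"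
    using q_tendsto[OF assms] convergentI convergent_imp_Bseq by blast
  then obtain M where "0 < M" "\<And>n. norm (P (X n)) \<le> M"
    by (auto simp: Bseq_def)
  then show ?thesis
    using that[of M] by (metis abs_ge_self less_imp_le order_trans real_norm_def)
qed

text \<open>The universal C*-algebra is the quotient of this *-algebra by the \<open>q\<close>-null
  sequences. Products stay Cauchy because Cauchy sequences are bounded.\<close>

sublocale seq: star_algebra_on CS seq_star seq_scale
proof
  fix X Y :: "nat \<Rightarrow> 'g free_elem" and c d :: complex
  show "0 \<in> CS"
    using CS_const[OF free.zero_mem] by (simp add: zero_fun_def)
  show "X + Y \<in> CS" if "X \<in> CS" "Y \<in> CS"
  proof (rule CS_I2[OF that, of _ 1 1])
    fix m n
    show "P ((X + Y) m - (X + Y) n) \<le> 1 * P (X m - X n) + 1 * P (Y m - Y n)"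
      using P.triangle[of "X m - X n" "Y m - Y n"] that
      by (simp add: CS_mem free.mem algebra_simps)
  qed (simp_all add: that CS_mem free.mem)
  show "X * Y \<in> CS" if XY: "X \<in> CS" "Y \<in> CS"
  proof -
    obtain K L where K: "0 \<le> K" "\<And>n. P (X n) \<le> K" and L: "0 \<le> L" "\<And>n. P (Y n) \<le> L"
      using CS_bounded[OF XY(1)] CS_bounded[OF XY(2)] by metis
    show ?thesis
    proof (rule CS_I2[OF XY, of _ L K])
      fix m n
      have "P ((X * Y) m - (X * Y) n) \<le> P (X m) * P (Y m - Y n) + P (X m - X n) * P (Y n)"
        using P.p_mult_diff[of "X m" "Y m" "X n" "Y n"] XY by (simp add: CS_mem)
      also have "\<dots> \<le> K * P (Y m - Y n) + P (X m - X n) * L"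
        by (intro add_mono mult_mono K L P.nonneg free.mem CS_mem XY order_refl)
      finally show "P ((X * Y) m - (X * Y) n) \<le> L * P (X m - X n) + K * P (Y m - Y n)"
        by (simp add: algebra_simps)
    qed (simp_all add: XY K L CS_mem free.mem)
  qed
  show "seq_star X \<in> CS" if "X \<in> CS"
    by (rule CS_I2[OF that that, of _ 1 0])
      (simp_all add: seq_star_def that CS_mem free.mem free.st_diff[symmetric] P.p_star)
  show "seq_scale c X \<in> CS" if "X \<in> CS"
    by (rule CS_I2[OF that that, of _ "cmod c" 0])
      (simp_all add: seq_scale_def that CS_mem free.mem free.sc_diff[symmetric] P.scale)
qed (simp_all add: seq_star_def seq_scale_def fun_eq_iff free.st_add free.st_mult free.st_st
  free.st_sc free.sc_add free.sc_add_left free.sc_sc free.sc_mult_left free.sc_mult_right free.sc_one)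

sublocale Q: cstar_seminorm_on CS seq_star seq_scale q
proof
  fix X Y :: "nat \<Rightarrow> 'g free_elem" and c :: complex
  assume X: "X \<in> CS"
  note qX = q_tendsto[OF X]
  show "0 \<le> q X"
    by (rule LIMSEQ_le_const[OF qX]) (simp add: CS_mem[OF X] P.nonneg)
  show "q (seq_scale c X) = cmod c * q X"
    by (rule q_eqI) (simp add: seq_scale_def P.scale CS_mem[OF X] tendsto_mult_left qX)
  show "q (seq_star X * X) = (q X)\<^sup>2"
    by (rule q_eqI) (simp add: seq_star_def P.cstar CS_mem[OF X] tendsto_power qX)
  assume Y: "Y \<in> CS"
  note qY = q_tendsto[OF Y]
  show "q (X + Y) \<le> q X + q Y"
    by (rule LIMSEQ_le[OF q_tendsto[OF seq.add_mem[OF X Y]] tendsto_add[OF qX qY]])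
      (simp add: P.triangle CS_mem[OF X] CS_mem[OF Y])
  show "q (X * Y) \<le> q X * q Y"
    by (rule LIMSEQ_le[OF q_tendsto[OF seq.mult_mem[OF X Y]] tendsto_mult[OF qX qY]])
      (simp add: P.submult CS_mem[OF X] CS_mem[OF Y])
qed

subsubsection \<open>Operations on classes\<close>

text \<open>Turns equality of classes into the vanishing of a seminorm, so that identities in the
  completion are proved by algebra on representatives.\<close>

lemma univ_rel_iff: "(X, Y) \<in> univ_rel G R \<longleftrightarrow> X \<in> CS \<and> Y \<in> CS \<and> q (X - Y) = 0"
proof -
  have "(\<lambda>n. P (X n - Y n)) \<longlonglongrightarrow> 0 \<longleftrightarrow> q (X - Y) = 0" if "X \<in> CS" "Y \<in> CS"
    using q_tendsto[OF seq.diff_mem[OF that]] q_eqI[of "X - Y" 0] by auto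
  then show ?thesis unfolding univ_rel_def by blast
qed

lemma equiv_univ_rel: "equiv CS (univ_rel G R)"
proof (rule equivI)
  show "univ_rel G R \<subseteq> CS \<times> CS" by (auto simp: univ_rel_iff)
  show "refl_on CS (univ_rel G R)"
    by (auto simp: refl_on_def univ_rel_iff Q.p_zero)
  show "sym (univ_rel G R)"
    by (auto simp: sym_def univ_rel_iff Q.p_diff_commute)
  show "trans (univ_rel G R)"
    using Q.null_trans by (auto simp: trans_def univ_rel_iff)
qed

lemma cls_eq_iff: "X \<in> CS \<Longrightarrow> Y \<in> CS \<Longrightarrow> cls X = cls Y \<longleftrightarrow> q (X - Y) = 0"
  unfolding univ_class_def
  by (subst eq_equiv_class_iff[OF equiv_univ_rel]) (simp_all add: univ_rel_iff)

lemma cls_mem: "X \<in> CS \<Longrightarrow> cls X \<in> sa_carrier U"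
  by (simp add: univ_cstar_def univ_class_def quotientI)

lemma carrier_cases:
  assumes "a \<in> sa_carrier U"
  obtains X where "X \<in> CS" "a = cls X"
  using assms unfolding univ_cstar_def univ_class_def by (auto elim: quotientE)

lemma empty_not_in_carrier: "{} \<notin> sa_carrier U"
  using in_quotient_imp_non_empty[OF equiv_univ_rel] by (auto simp: univ_cstar_def)

lemma add_cls: "X \<in> CS \<Longrightarrow> Y \<in> CS \<Longrightarrow> sa_add U (cls X) (cls Y) = cls (X + Y)"
proof -
  assume XY: "X \<in> CS" "Y \<in> CS"
  have "congruent2 (univ_rel G R) (univ_rel G R) (\<lambda>X Y. cls (\<lambda>n. X n + Y n))"
  proof (rule congruent2I')
    fix X X' Y Y' assume *: "(X, X') \<in> univ_rel G R" "(Y, Y') \<in> univ_rel G R"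
    then have mem: "X \<in> CS" "X' \<in> CS" "Y \<in> CS" "Y' \<in> CS"
      and null: "q (X - X') = 0" "q (Y - Y') = 0"
      by (simp_all add: univ_rel_iff)
    have "q ((X - X') + (Y - Y')) = 0"
      by (intro Q.null_add seq.diff_mem mem null)
    moreover have "(X + Y) - (X' + Y') = (X - X') + (Y - Y')"
      by (rule add_diff_add)
    ultimately show "cls (\<lambda>n. X n + Y n) = cls (\<lambda>n. X' n + Y' n)"
      using cls_eq_iff[OF seq.add_mem[OF mem(1,3)] seq.add_mem[OF mem(2,4)]]
      by (simp add: plus_fun_def)
  qed
  from UN_equiv_class2[OF equiv_univ_rel equiv_univ_rel this XY]
  show ?thesis by (simp add: univ_cstar_def univ_class_def plus_fun_def)
qed

lemma mult_cls: "X \<in> CS \<Longrightarrow> Y \<in> CS \<Longrightarrow> sa_mult U (cls X) (cls Y) = cls (X * Y)"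
proof -
  assume XY: "X \<in> CS" "Y \<in> CS"
  have "congruent2 (univ_rel G R) (univ_rel G R) (\<lambda>X Y. cls (\<lambda>n. X n * Y n))"
  proof (rule congruent2I')
    fix X X' Y Y' assume *: "(X, X') \<in> univ_rel G R" "(Y, Y') \<in> univ_rel G R"
    then have mem: "X \<in> CS" "X' \<in> CS" "Y \<in> CS" "Y' \<in> CS"
      and null: "q (X - X') = 0" "q (Y - Y') = 0"
      by (simp_all add: univ_rel_iff)
    have "q (X * Y - X' * Y') = 0"
      using Q.p_mult_diff[OF mem(1,3,2,4)] Q.nonneg[of "X * Y - X' * Y'"] null
      by (simp add: seq.mult_mem seq.diff_mem mem)
    then show "cls (\<lambda>n. X n * Y n) = cls (\<lambda>n. X' n * Y' n)"
      using cls_eq_iff[OF seq.mult_mem[OF mem(1,3)] seq.mult_mem[OF mem(2,4)]]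
      by (simp add: times_fun_def)
  qed
  from UN_equiv_class2[OF equiv_univ_rel equiv_univ_rel this XY]
  show ?thesis by (simp add: univ_cstar_def univ_class_def times_fun_def)
qed

lemma scale_cls: "X \<in> CS \<Longrightarrow> sa_scale U c (cls X) = cls (seq_scale c X)"
proof -
  assume X: "X \<in> CS"
  have "congruent (univ_rel G R) (\<lambda>X. cls (seq_scale c X))"
    by (rule congruentI)
      (auto simp: univ_rel_iff cls_eq_iff seq.mem seq.sc_diff[symmetric] Q.scale)
  from UN_equiv_class[OF equiv_univ_rel this X]
  show ?thesis by (simp add: univ_cstar_def univ_class_def seq_scale_def)
qed

lemma star_cls: "X \<in> CS \<Longrightarrow> sa_star U (cls X) = cls (seq_star X)"
proof -
  assume X: "X \<in> CS"
  have "congruent (univ_rel G R) (\<lambda>X. cls (seq_star X))"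
    by (rule congruentI)
      (auto simp: univ_rel_iff cls_eq_iff seq.mem seq.st_diff[symmetric] Q.p_star)
  from UN_equiv_class[OF equiv_univ_rel this X]
  show ?thesis by (simp add: univ_cstar_def univ_class_def seq_star_def)
qed

lemma norm_cls: 
  assumes X: "X \<in> CS"
  shows "sa_norm U (cls X) = q X"
proof -
  have "q Y = q X" if "Y \<in> cls X" for Y
    using that Q.p_eq_if_null[of X Y] by (auto simp: univ_class_def univ_rel_iff)
  moreover have "X \<in> cls X"
    using X by (simp add: univ_class_def univ_rel_iff Q.p_zero)
  ultimately have "q ` cls X = {q X}" by blast
  then show ?thesis by (simp add: univ_cstar_def q_def[abs_def])
qed

lemma cls_const_eqI:
  assumes "a \<in> A" "b \<in> A" "P (a - b) = 0"
  shows "cls (\<lambda>_. a) = cls (\<lambda>_. b)"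
  using assms by (simp add: cls_eq_iff CS_const fun_diff_def q_const)

lemma mult_cls_const:
  "a \<in> A \<Longrightarrow> b \<in> A \<Longrightarrow> sa_mult U (cls (\<lambda>_. a)) (cls (\<lambda>_. b)) = cls (\<lambda>_. a * b)"
  by (simp add: mult_cls CS_const times_fun_def)

lemma star_cls_const: "a \<in> A \<Longrightarrow> sa_star U (cls (\<lambda>_. a)) = cls (\<lambda>_. free_star a)"
  by (simp add: star_cls CS_const seq_star_def)

lemma carrier_add: "a \<in> sa_carrier U \<Longrightarrow> b \<in> sa_carrier U \<Longrightarrow> sa_add U a b \<in> sa_carrier U"
  by (elim carrier_cases) (simp add: add_cls cls_mem seq.mem)

lemma carrier_mult: "a \<in> sa_carrier U \<Longrightarrow> b \<in> sa_carrier U \<Longrightarrow> sa_mult U a b \<in> sa_carrier U"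
  by (elim carrier_cases) (simp add: mult_cls cls_mem seq.mem)

lemma carrier_scale: "a \<in> sa_carrier U \<Longrightarrow> sa_scale U c a \<in> sa_carrier U"
  by (elim carrier_cases) (simp add: scale_cls cls_mem seq.mem)

lemma carrier_star: "a \<in> sa_carrier U \<Longrightarrow> sa_star U a \<in> sa_carrier U"
  by (elim carrier_cases) (simp add: star_cls cls_mem seq.mem)

end

subsection \<open>Automatic contractivity of *-homomorphisms\<close>

text \<open>
  Fixed point iteration for \<open>r = (a\<^sup>2 + r\<^sup>2) / 2\<close>, that is, \<open>1 - r = sqrt (1 - a\<^sup>2)\<close>.
\<close>

fun sqrt_iter :: "nat \<Rightarrow> 'g free_elem \<Rightarrow> 'g free_elem" where
  "sqrt_iter 0 a = 0"
| "sqrt_iter (Suc m) a = free_scale (1/2) (a * a + sqrt_iter m a * sqrt_iter m a)"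

context bounded_relations
begin

lemma sqrt_iter_mem: "a \<in> A \<Longrightarrow> sqrt_iter m a \<in> A"
  by (induction m) (simp_all add: free.mem)

lemma sqrt_iter_star:
  fixes a :: "'g free_elem"
  shows "free_star a = a \<Longrightarrow> free_star (sqrt_iter m a) = sqrt_iter m a"
  by (induction m) (simp_all add: free.st_zero free.st_sc free.st_add free.st_mult)

lemma sqrt_iter_commute:
  fixes a :: "'g free_elem"
  shows "a * sqrt_iter m a = sqrt_iter m a * a"
proof (induction m)
  case (Suc m)
  have "a * (sqrt_iter m a * sqrt_iter m a) = (sqrt_iter m a * sqrt_iter m a) * a"
    by (metis Suc mult.assoc)
  then show ?case
    by (simp add: free.sc_mult_left free.sc_mult_right distrib_left distrib_right mult.assoc)
qed simp

lemma P_half: "a \<in> A \<Longrightarrow> P (free_scale (1/2) a) = P a / 2"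
  by (simp add: P.scale)

text \<open>The ball of radius \<open>k\<close> is invariant under the iteration, as
  \<open>(k * k + k * k) / 2 \<le> k\<close>.\<close>

lemma sqrt_iter_le:
  assumes "a \<in> A" "P a \<le> k" "k < 1"
  shows "P (sqrt_iter m a) \<le> k"
proof (induction m)
  case 0
  then show ?case using P.nonneg[of a] assms by (simp add: P.p_zero)
next
  case (Suc m)
  have r: "sqrt_iter m a \<in> A" using assms sqrt_iter_mem by blast
  have k: "0 \<le> k" using P.nonneg[of a] assms by simp
  have "P (a * a + sqrt_iter m a * sqrt_iter m a) \<le> P (a * a) + P (sqrt_iter m a * sqrt_iter m a)"
    by (intro P.triangle free.mem assms r)
  also have "\<dots> \<le> P a * P a + P (sqrt_iter m a) * P (sqrt_iter m a)"
    by (intro add_mono P.submult free.mem assms r)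
  also have "\<dots> \<le> k * 1 + k * 1"
    using assms Suc k by (intro add_mono mult_mono P.nonneg r) auto
  finally show ?case
    using assms r by (simp add: P_half free.mem)
qed

text \<open>On the ball of radius \<open>k\<close>, squaring has Lipschitz constant
  \<open>2 * k\<close>, which the factor \<open>1/2\<close> halves. The estimate yields both
  convergence in the index and continuity in the argument.\<close>

lemma P_sqrt_step:
  assumes "a \<in> A" "b \<in> A" "r \<in> A" "s \<in> A" "P a \<le> k" "P b \<le> k" "P r \<le> k" "P s \<le> k"
  shows "P (free_scale (1/2) (a * a + r * r) - free_scale (1/2) (b * b + s * s))
    \<le> k * (P (a - b) + P (r - s))"
proof -
  have sq: "P (x * x - z * z) \<le> 2 * k * P (x - z)"
    if "x \<in> A" "z \<in> A" "P x \<le> k" "P z \<le> k" for x z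
  proof -
    have "P (x * x - z * z) \<le> P x * P (x - z) + P (x - z) * P z"
      using that by (intro P.p_mult_diff)
    also have "\<dots> \<le> k * P (x - z) + P (x - z) * k"
      using that by (intro add_mono mult_right_mono mult_left_mono P.nonneg free.mem)
    finally show ?thesis by simp
  qed
  have "P (free_scale (1/2) (a * a + r * r) - free_scale (1/2) (b * b + s * s))
    = P ((a * a - b * b) + (r * r - s * s)) / 2"
    using assms by (simp add: free.sc_diff[symmetric] P_half free.mem add_diff_add)
  also have "\<dots> \<le> (P (a * a - b * b) + P (r * r - s * s)) / 2"
    using assms by (intro divide_right_mono P.triangle free.mem) auto
  also have "\<dots> \<le> (2 * k * P (a - b) + 2 * k * P (r - s)) / 2"
    using assms by (intro divide_right_mono add_mono sq) auto
  finally show ?thesis by (simp add: algebra_simps)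
qed

text \<open>Every iteration contracts by the factor \<open>k\<close>. The bound depends on neither
  \<open>a\<close> nor \<open>j\<close>, as the diagonal sequence below requires.\<close>

lemma sqrt_iter_Cauchy:
  assumes "a \<in> A" "P a \<le> k" "k < 1"
  shows "P (sqrt_iter (m + j) a - sqrt_iter m a) \<le> k * k ^ m"
proof (induction m)
  case 0
  then show ?case using sqrt_iter_le[OF assms, of j] by simp
next
  case (Suc m)
  have k: "0 \<le> k" using P.nonneg[of a] assms by simp
  have "P (sqrt_iter (Suc (m + j)) a - sqrt_iter (Suc m) a)
    \<le> k * (P (a - a) + P (sqrt_iter (m + j) a - sqrt_iter m a))"
    unfolding sqrt_iter.simps
    by (intro P_sqrt_step assms sqrt_iter_mem sqrt_iter_le[OF assms(1)])
  also have "\<dots> \<le> k * (k * k ^ m)"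
    using Suc k by (intro mult_left_mono) (simp_all add: P.p_zero)
  finally show ?case by simp
qed

text \<open>The constant \<open>L = k / (1 - k)\<close> solves \<open>L = k * (1 + L)\<close> and is
  therefore stable under the step estimate.\<close>

lemma sqrt_iter_Lipschitz:
  assumes "a \<in> A" "b \<in> A" "P a \<le> k" "P b \<le> k" "k < 1"
  shows "P (sqrt_iter m a - sqrt_iter m b) \<le> k / (1 - k) * P (a - b)"
proof (induction m)
  case 0
  then show ?case using P.nonneg[of a] P.nonneg[of "a - b"] assms by (simp add: P.p_zero free.mem)
next
  case (Suc m)
  have k: "0 \<le> k" using P.nonneg[of a] assms by simp
  have "P (sqrt_iter (Suc m) a - sqrt_iter (Suc m) b)
    \<le> k * (P (a - b) + P (sqrt_iter m a - sqrt_iter m b))"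
    unfolding sqrt_iter.simps
    by (intro P_sqrt_step assms sqrt_iter_mem sqrt_iter_le[OF assms(1)] sqrt_iter_le[OF assms(2)])
  also have "\<dots> \<le> k * (P (a - b) + k / (1 - k) * P (a - b))"
    using Suc k by (intro mult_left_mono) simp_all
  also have "\<dots> = k / (1 - k) * P (a - b)"
    using assms by (simp add: field_simps)
  finally show ?case .
qed

text \<open>The root of a class is represented diagonally, by the \<open>n\<close>-th iterate at the
  \<open>n\<close>-th term. Passing through a fixed index \<open>N\<close> leaves two uniform tails
  and a difference at \<open>N\<close>, which is controlled by the Lipschitz bound.\<close>

lemma sqrt_iter_seq_mem:
  assumes X: "X \<in> CS" and le: "\<And>n. P (X n) \<le> k" and k: "0 \<le> k" "k < 1"
  shows "(\<lambda>n. sqrt_iter n (X n)) \<in> CS"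
  unfolding CS_iff
proof (intro conjI allI impI)
  note XA = CS_mem[OF X]
  show "sqrt_iter n (X n) \<in> A" for n
    using XA by (rule sqrt_iter_mem)
  fix e :: real assume e: "0 < e"
  define L where "L = k / (1 - k)"
  have L: "0 \<le> L" using k by (simp add: L_def)
  have "(\<lambda>n. k * k ^ n) \<longlonglongrightarrow> k * 0"
    using k by (intro tendsto_intros LIMSEQ_power_zero) auto
  then have "\<forall>\<^sub>F n in sequentially. k * k ^ n < e / 3"
    using e by (intro order_tendstoD(2)[where y = "k * 0"]) auto
  then obtain N where N: "k * k ^ N < e / 3"
    by (auto simp: eventually_sequentially)
  \<comment> \<open>\<open>L + 1\<close> in place of \<open>L\<close> keeps the denominator
    positive.\<close>
  obtain M where M: "\<And>m n. m \<ge> M \<Longrightarrow> n \<ge> M \<Longrightarrow> P (X m - X n) < e / 3 / (L + 1)"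
    using CS_E[OF X, of "e / 3 / (L + 1)"] e L by (auto simp: field_simps)
  have "P (sqrt_iter m (X m) - sqrt_iter n (X n)) < e" if mn: "m \<ge> max M N" "n \<ge> max M N" for m n
  proof -
    have tail: "P (sqrt_iter i (X i) - sqrt_iter N (X i)) < e / 3" if "i \<ge> N" for i
      using sqrt_iter_Cauchy[OF XA le k(2), of N "i - N" i] that N by simp
    have "P (sqrt_iter N (X m) - sqrt_iter N (X n)) \<le> L * P (X m - X n)"
      unfolding L_def by (intro sqrt_iter_Lipschitz XA le k)
    also have "\<dots> \<le> (L + 1) * P (X m - X n)"
      using P.nonneg[of "X m - X n"] XA by (simp add: free.mem algebra_simps)
    also have "\<dots> < e / 3"
      using M[of m n] mn L by (simp add: field_simps)
    finally have mid: "P (sqrt_iter N (X m) - sqrt_iter N (X n)) < e / 3" .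
    have mem: "sqrt_iter i (X j) \<in> A" for i j
      using XA by (rule sqrt_iter_mem)
    have "P (sqrt_iter m (X m) - sqrt_iter n (X n))
      \<le> P (sqrt_iter m (X m) - sqrt_iter N (X m)) + P (sqrt_iter N (X m) - sqrt_iter n (X n))"
      by (intro P.triangle_via mem)
    also have "\<dots> \<le> P (sqrt_iter m (X m) - sqrt_iter N (X m)) +
      (P (sqrt_iter N (X m) - sqrt_iter N (X n)) + P (sqrt_iter N (X n) - sqrt_iter n (X n)))"
      by (intro add_left_mono P.triangle_via mem)
    also have "P (sqrt_iter N (X n) - sqrt_iter n (X n)) = P (sqrt_iter n (X n) - sqrt_iter N (X n))"
      by (intro P.p_diff_commute mem)
    finally show ?thesis
      using tail[of m] tail[of n] mid mn by simp
  qed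
  then show "\<exists>N. \<forall>m\<ge>N. \<forall>n\<ge>N. P (sqrt_iter m (X m) - sqrt_iter n (X n)) < e" by blast
qed

text \<open>At index \<open>n\<close> the defect is \<open>-2\<close> times the step from iterate
  \<open>n\<close> to iterate \<open>n + 1\<close> at the same argument \<open>X n\<close>, hence
  geometrically small.\<close>

lemma sqrt_iter_null:
  assumes X: "X \<in> CS" and le: "\<And>n. P (X n) \<le> k" and k: "0 \<le> k" "k < 1"
  defines "r \<equiv> \<lambda>n. sqrt_iter n (X n)"
  shows "q (r + r - r * r - X * X) = 0"
proof (rule q_eqI, rule tendsto_sandwich)
  note XA = CS_mem[OF X]
  have mem: "sqrt_iter i (X j) \<in> A" for i j
    using XA by (rule sqrt_iter_mem)
  have eq: "(r + r - r * r - X * X) n = free_scale (- 2) (sqrt_iter (n + 1) (X n) - sqrt_iter n (X n))"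
    for n
    using free.sc_add_left[of 1 1 "sqrt_iter n (X n)"]
    by (simp add: r_def free.sc_diff free.sc_sc free.sc_minus_left free.sc_one algebra_simps)
  show "\<forall>\<^sub>F n in sequentially. 0 \<le> P ((r + r - r * r - X * X) n)"
    by (simp only: eq) (auto simp del: sqrt_iter.simps
      intro!: always_eventually P.nonneg free.sc_mem free.diff_mem mem)
  show "\<forall>\<^sub>F n in sequentially. P ((r + r - r * r - X * X) n) \<le> 2 * (k * k ^ n)"
  proof (intro always_eventually allI)
    fix n
    show "P ((r + r - r * r - X * X) n) \<le> 2 * (k * k ^ n)"
      using sqrt_iter_Cauchy[OF XA le k(2), of n 1 n]
      by (simp only: eq) (simp add: P.scale free.diff_mem mem del: sqrt_iter.simps)
  qed
  show "(\<lambda>n. 2 * (k * k ^ n)) \<longlonglongrightarrow> 0"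
    using k by (auto intro!: tendsto_mult_right_zero LIMSEQ_power_zero)
qed simp

text \<open>The root of \<open>1 - X * X\<close> exists on representatives, and its equation holds
  up to a \<open>q\<close>-null sequence. As \<open>N\<close> kills such sequences,
  \<open>le_one_if_sqrt\<close> applies to \<open>N\<close>.\<close>

lemma le_one_if_selfadjoint:
  assumes N: "cstar_seminorm_on CS seq_star seq_scale N"
    and null: "\<And>X. X \<in> CS \<Longrightarrow> q X = 0 \<Longrightarrow> N X = 0"
    and X: "X \<in> CS" "seq_star X = X" "q X < 1"
  shows "N X \<le> 1"
proof -
  interpret N: cstar_seminorm_on CS seq_star seq_scale N by (rule N)
  obtain k where k: "q X < k" "k < 1"
    using X dense by blast
  have k0: "0 \<le> k"
    using Q.nonneg[OF X(1)] k by simp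
  have "\<forall>\<^sub>F n in sequentially. P (X n) < k"
    by (rule order_tendstoD(2)[OF q_tendsto[OF X(1)] k(1)])
  then obtain n0 where n0: "\<And>n. n \<ge> n0 \<Longrightarrow> P (X n) < k"
    by (auto simp: eventually_sequentially)
  \<comment> \<open>Dropping the first \<open>n0\<close> terms makes the bound \<open>k\<close> hold
    at every index, as the iteration requires, and changes \<open>X\<close> only by a
    \<open>q\<close>-null sequence.\<close>
  define X' where "X' = (\<lambda>n. X (n + n0))"
  have Cauchy: "\<exists>N. \<forall>m\<ge>N. \<forall>n\<ge>N. P (X m - X n) < e" if "0 < e" for e
    using X(1) that by (simp add: CS_iff)
  have X': "X' \<in> CS"
    unfolding CS_iff X'_def
  proof (intro conjI allI impI)
    fix e :: real assume "0 < e"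
    then obtain N where "\<forall>m\<ge>N. \<forall>n\<ge>N. P (X m - X n) < e" using Cauchy by blast
    then have "\<forall>m\<ge>N. \<forall>n\<ge>N. P (X (m + n0) - X (n + n0)) < e" by simp
    then show "\<exists>N. \<forall>m\<ge>N. \<forall>n\<ge>N. P (X (m + n0) - X (n + n0)) < e" by blast
  qed (rule CS_mem[OF X(1)])
  have "q (X - X') = 0"
  proof (rule q_eqI, rule LIMSEQ_I)
    fix e :: real assume "0 < e"
    then obtain N where "\<forall>m\<ge>N. \<forall>n\<ge>N. P (X m - X n) < e" using Cauchy by blast
    then have "\<forall>n\<ge>N. norm (P ((X - X') n) - 0) < e"
      by (simp add: X'_def P.nonneg free.diff_mem CS_mem[OF X(1)])
    then show "\<exists>N. \<forall>n\<ge>N. norm (P ((X - X') n) - 0) < e" by blast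
  qed
  then have "N X = N X'"
    by (intro N.p_eq_if_null X X' null seq.diff_mem)
  moreover have "N X' \<le> 1"
  proof (rule N.le_one_if_sqrt)
    have le: "P (X' n) \<le> k" for n
      using n0[of "n + n0"] by (simp add: X'_def)
    show "(\<lambda>n. sqrt_iter n (X' n)) \<in> CS"
      by (rule sqrt_iter_seq_mem[OF X' le k0 k(2)])
    then show "N ((\<lambda>n. sqrt_iter n (X' n)) + (\<lambda>n. sqrt_iter n (X' n)) -
      (\<lambda>n. sqrt_iter n (X' n)) * (\<lambda>n. sqrt_iter n (X' n)) - X' * X') = 0"
      by (intro null sqrt_iter_null[OF X' le k0 k(2)] seq.diff_mem seq.add_mem seq.mult_mem X')
    have sa: "free_star (X' n) = X' n" for n
      using X(2) by (auto simp: seq_star_def X'_def fun_eq_iff)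
    then show "seq_star X' = X'" "seq_star (\<lambda>n. sqrt_iter n (X' n)) = (\<lambda>n. sqrt_iter n (X' n))"
      by (simp_all add: seq_star_def sqrt_iter_star)
    show "X' * (\<lambda>n. sqrt_iter n (X' n)) = (\<lambda>n. sqrt_iter n (X' n)) * X'"
      by (simp add: fun_eq_iff sqrt_iter_commute)
  qed (rule X')
  ultimately show ?thesis by simp
qed

text \<open>Rescaling by any \<open>t\<close> above \<open>q Y\<close> extends the unit ball
  estimate to all self-adjoint \<open>Y\<close>; the C*-identity reduces a general \<open>X\<close>
  to \<open>seq_star X * X\<close>.\<close>

lemma cstar_seminorm_le_q:
  assumes N: "cstar_seminorm_on CS seq_star seq_scale N"
    and null: "\<And>X. X \<in> CS \<Longrightarrow> q X = 0 \<Longrightarrow> N X = 0"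
    and X: "X \<in> CS"
  shows "N X \<le> q X"
proof -
  interpret N: cstar_seminorm_on CS seq_star seq_scale N by (rule N)
  have sa: "N Y \<le> q Y" if Y: "Y \<in> CS" "seq_star Y = Y" for Y
  proof (rule dense_ge)
    fix t assume t: "q Y < t"
    then have t0: "0 < t" using Q.nonneg[OF Y(1)] by simp
    define Z where "Z = seq_scale (1 / complex_of_real t) Y"
    have cm: "cmod (1 / complex_of_real t) = 1 / t"
      using t0 by (simp add: norm_divide)
    have "Z \<in> CS" "seq_star Z = Z" "q Z < 1"
      using Y t t0 unfolding Z_def
      by (simp_all only: seq.sc_mem seq.st_sc Q.scale cm) (simp_all add: field_simps)
    then have "N Z \<le> 1"
      by (intro le_one_if_selfadjoint[OF N] null)
    then show "N Y \<le> t"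
      using t0 unfolding Z_def N.scale[OF Y(1)] cm by (simp add: field_simps)
  qed
  have "N (seq_star X * X) \<le> q (seq_star X * X)"
    using X by (intro sa) (simp_all add: seq.mem seq.st_mult seq.st_st)
  then show ?thesis
    using power2_le_imp_le[of "N X" "q X"] Q.nonneg[OF X]
    unfolding N.cstar[OF X] Q.cstar[OF X] by simp
qed

end

section \<open>*-homomorphisms between universal C*-algebras\<close>

locale bounded_relations_pair =
  A: bounded_relations G R + B: bounded_relations G' R'
  for G :: "'g set" and R and G' :: "'h set" and R'
begin

lemma star_hom_cls:
  assumes "star_hom A.U B.U h" "X \<in> A.CS"
  obtains Y where "Y \<in> B.CS" "h (A.cls X) = B.cls Y"
  using assms A.cls_mem[of X] B.carrier_cases[of "h (A.cls X)"]
  by (auto simp: star_hom_def Pi_iff)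

text \<open>The norm pulled back along \<open>h\<close> is a C*-seminorm on Cauchy sequences, and it
  vanishes on \<open>q\<close>-null ones because \<open>h\<close> is defined on classes;
  \<open>cstar_seminorm_le_q\<close> then bounds it.\<close>

lemma star_hom_contractive:
  assumes h: "star_hom A.U B.U h" and X: "X \<in> A.CS"
  shows "sa_norm B.U (h (A.cls X)) \<le> A.q X"
proof -
  have ex: "\<exists>Y. Y \<in> B.CS \<and> h (A.cls X) = B.cls Y" if "X \<in> A.CS" for X
    using star_hom_cls[OF h that] by blast
  \<comment> \<open>\<open>T\<close> picks representatives of the values. It respects the operations
    only up to null sequences, which \<open>B.q\<close> does not see.\<close>
  then obtain T where T: "\<And>X. X \<in> A.CS \<Longrightarrow> T X \<in> B.CS"
    "\<And>X. X \<in> A.CS \<Longrightarrow> h (A.cls X) = B.cls (T X)"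
    by metis
  let ?N = "\<lambda>X. sa_norm B.U (h (A.cls X))"
  have add: "?N (X + Y) = B.q (T X + T Y)" if "X \<in> A.CS" "Y \<in> A.CS" for X Y
    using h that A.cls_mem[of X] A.cls_mem[of Y] unfolding star_hom_def
    by (simp add: A.add_cls[symmetric] T B.add_cls B.norm_cls B.seq.mem)
  have mult: "?N (X * Y) = B.q (T X * T Y)" if "X \<in> A.CS" "Y \<in> A.CS" for X Y
    using h that A.cls_mem[of X] A.cls_mem[of Y] unfolding star_hom_def
    by (simp add: A.mult_cls[symmetric] T B.mult_cls B.norm_cls B.seq.mem)
  have scale: "?N (seq_scale c X) = B.q (seq_scale c (T X))" if "X \<in> A.CS" for c X
    using h that A.cls_mem[of X] unfolding star_hom_def
    by (simp add: A.scale_cls[symmetric] T B.scale_cls B.norm_cls B.seq.mem)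
  have star: "?N (seq_star X * X) = B.q (seq_star (T X) * T X)" if X: "X \<in> A.CS" for X
    using h A.cls_mem[OF X] A.cls_mem[OF A.seq.st_mem[OF X]] unfolding star_hom_def
    by (simp add: A.mult_cls[symmetric] A.star_cls[symmetric] A.seq.mem X T
        B.mult_cls B.star_cls B.norm_cls B.seq.mem)
  have "cstar_seminorm_on A.CS seq_star seq_scale ?N"
  proof
    fix X Y c assume X: "X \<in> A.CS"
    show "0 \<le> ?N X" "?N (seq_scale c X) = cmod c * ?N X" "?N (seq_star X * X) = (?N X)\<^sup>2"
      using X by (simp_all add: B.norm_cls scale star T B.Q.nonneg B.Q.scale B.Q.cstar)
    assume Y: "Y \<in> A.CS"
    show "?N (X + Y) \<le> ?N X + ?N Y" "?N (X * Y) \<le> ?N X * ?N Y"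
      using X Y by (simp_all add: B.norm_cls add mult T B.Q.triangle B.Q.submult)
  qed
  moreover have "?N X = 0" if X: "X \<in> A.CS" "A.q X = 0" for X
  proof -
    \<comment> \<open>A null sequence has the class of its own zero multiple, and \<open>h\<close>
      commutes with scaling.\<close>
    have "A.cls X = A.cls (seq_scale 0 X)"
      using X by (subst A.cls_eq_iff) (simp_all add: A.seq.mem A.seq.sc_zero_left)
    then have "?N X = ?N (seq_scale 0 X)" by simp
    also have "\<dots> = 0" using X by (simp add: scale B.Q.scale T)
    finally show ?thesis .
  qed
  ultimately show ?thesis using X by (rule A.cstar_seminorm_le_q)
qed

text \<open>Agreement on generators spreads to constant sequences by induction over the free
  algebra. Constant sequences are dense, and contractivity carries the equality to limits.\<close>

theorem star_hom_eqI:
  assumes h: "star_hom A.U B.U h" and h': "star_hom A.U B.U h'"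
    and gen: "\<And>g. g \<in> G \<Longrightarrow> h (univ_gen G R g) = h' (univ_gen G R g)"
    and a: "a \<in> sa_carrier A.U"
  shows "h a = h' a"
proof -
  have const: "h (A.cls (\<lambda>_. b)) = h' (A.cls (\<lambda>_. b))" if "b \<in> A.A" for b
    using that
  proof (induction b rule: free_star_alg_induct)
    case (gen g)
    then show ?case using assms(3) by (simp add: univ_gen_def)
  next
    case (add a b)
    have "A.cls (\<lambda>_. a + b) = sa_add A.U (A.cls (\<lambda>_. a)) (A.cls (\<lambda>_. b))"
      using add by (simp add: A.add_cls A.CS_const plus_fun_def)
    then show ?case
      using h h' add unfolding star_hom_def by (simp add: A.cls_mem A.CS_const)
  next
    case (mult a b)
    have "A.cls (\<lambda>_. a * b) = sa_mult A.U (A.cls (\<lambda>_. a)) (A.cls (\<lambda>_. b))"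
      using mult by (simp add: A.mult_cls_const)
    then show ?case
      using h h' mult unfolding star_hom_def by (simp add: A.cls_mem A.CS_const)
  next
    case (star a)
    have "A.cls (\<lambda>_. free_star a) = sa_star A.U (A.cls (\<lambda>_. a))"
      using star by (simp add: A.star_cls_const)
    then show ?case
      using h h' star unfolding star_hom_def by (simp add: A.cls_mem A.CS_const)
  next
    case (scale a c)
    have *: "A.cls (\<lambda>_. free_scale c a) = sa_scale A.U c (A.cls (\<lambda>_. a))" if "a \<in> A.A" for a c
      using that by (simp add: A.scale_cls A.CS_const seq_scale_def)
    then show ?case
      using h h' scale unfolding star_hom_def by (simp add: A.cls_mem A.CS_const)
  next
    case zero
    \<comment> \<open>\<open>star_hom\<close> has no clause for zero; it is obtained as a multiple
      by the scalar \<open>0\<close>.\<close>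
    have "g (A.cls 0) = B.cls 0" if g: "star_hom A.U B.U g" for g
    proof -
      obtain Z where Z: "Z \<in> B.CS" "g (A.cls 0) = B.cls Z"
        using star_hom_cls[OF g A.seq.zero_mem] .
      have "sa_scale A.U 0 (A.cls 0) = A.cls 0"
        by (simp add: A.scale_cls A.seq.mem A.seq.sc_zero)
      then have "g (A.cls 0) = sa_scale B.U 0 (B.cls Z)"
        using g Z A.cls_mem[OF A.seq.zero_mem] unfolding star_hom_def by metis
      then show ?thesis using Z by (simp add: B.scale_cls B.seq.sc_zero_left)
    qed
    from this[OF h] this[OF h'] show ?case by (simp add: zero_fun_def)
  qed
  obtain X where X: "X \<in> A.CS" "a = A.cls X"
    using a by (rule A.carrier_cases)
  obtain Y where Y: "Y \<in> B.CS" "h a = B.cls Y"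
    using star_hom_cls[OF h X(1)] X by metis
  obtain Y' where Y': "Y' \<in> B.CS" "h' a = B.cls Y'"
    using star_hom_cls[OF h' X(1)] X by metis
  \<comment> \<open>Both homomorphisms agree at the constant sequence with value \<open>X m\<close>,
    and each moves away from that common value by at most the distance from \<open>X\<close> to
    it.\<close>
  have bound: "B.q (Y - Y') \<le> 2 * A.q (X - (\<lambda>_. X m))" for m
  proof -
    define C where "C = (\<lambda>_::nat. X m)"
    have C: "C \<in> A.CS" "X - C \<in> A.CS"
      using X by (simp_all add: C_def A.CS_const A.CS_mem A.seq.mem)
    obtain W where W: "W \<in> B.CS" "h (A.cls C) = B.cls W"
      using star_hom_cls[OF h C(1)] .
    moreover have "h' (A.cls C) = h (A.cls C)"
      unfolding C_def by (rule const[OF A.CS_mem[OF X(1)], symmetric])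
    ultimately have W': "h' (A.cls C) = B.cls W" by simp
    have split: "B.q (V - W) \<le> A.q (X - C)"
      if g: "star_hom A.U B.U g" "g (A.cls C) = B.cls W" and V: "V \<in> B.CS" "g a = B.cls V" for g V
    proof -
      obtain Z where Z: "Z \<in> B.CS" "g (A.cls (X - C)) = B.cls Z"
        using star_hom_cls[OF g(1) C(2)] .
      have "a = sa_add A.U (A.cls (X - C)) (A.cls C)"
        using C X by (simp add: A.add_cls)
      then have "g a = sa_add B.U (B.cls Z) (B.cls W)"
        using g Z C A.cls_mem unfolding star_hom_def by simp
      then have "B.cls V = B.cls (Z + W)"
        using V Z W by (simp add: B.add_cls)
      then have "B.q (V - (Z + W)) = 0"
        using V Z W by (simp add: B.cls_eq_iff B.seq.mem)
      then have "B.q ((V - W) - Z) = 0"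
        by (simp add: diff_diff_eq add.commute)
      then have "B.q (V - W) = B.q Z"
        using V Z W by (intro B.Q.p_eq_if_null B.seq.diff_mem)
      also have "\<dots> \<le> A.q (X - C)"
        using star_hom_contractive[OF g(1) C(2)] Z by (simp add: B.norm_cls)
      finally show ?thesis .
    qed
    have "B.q (Y - Y') \<le> B.q (Y - W) + B.q (W - Y')"
      by (intro B.Q.triangle_via Y Y' W)
    also have "B.q (W - Y') = B.q (Y' - W)"
      by (intro B.Q.p_diff_commute Y' W)
    finally show ?thesis
      using split[OF h W(2) Y] split[OF h' W' Y'] unfolding C_def by linarith
  qed
  have "B.q (Y - Y') \<le> 0 + e" if e: "0 < e" for e
  proof -
    obtain N where N: "\<And>m n. m \<ge> N \<Longrightarrow> n \<ge> N \<Longrightarrow> A.P (X m - X n) < e / 2"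
      using A.CS_E[OF X(1), of "e / 2"] e by auto
    have "A.q (X - (\<lambda>_. X N)) \<le> e / 2"
    proof (rule LIMSEQ_le_const2)
      show "(\<lambda>n. A.P ((X - (\<lambda>_. X N)) n)) \<longlonglongrightarrow> A.q (X - (\<lambda>_. X N))"
        by (intro A.q_tendsto A.seq.diff_mem X A.CS_const A.CS_mem)
      show "\<exists>M. \<forall>n\<ge>M. A.P ((X - (\<lambda>_. X N)) n) \<le> e / 2"
        using N by (auto intro!: exI[of _ N] less_imp_le)
    qed
    then show ?thesis using bound[of N] by simp
  qed
  then have "B.q (Y - Y') \<le> 0" by (rule field_le_epsilon)
  then have "B.q (Y - Y') = 0"
    using B.Q.nonneg[OF B.seq.diff_mem[OF Y(1) Y'(1)]] by simp
  then show ?thesis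
    using Y Y' by (simp add: B.cls_eq_iff)
qed

end

subsection \<open>Graph C*-algebras\<close>

context bounded_relations_pair
begin

lemma star_hom_inverse:
  assumes f: "star_iso A.U B.U f"
  shows "star_hom B.U A.U (inverse_hom A.U B.U f)"
proof -
  let ?g = "inverse_hom A.U B.U f"
  have hom: "star_hom A.U B.U f" and bij: "bij_betw f (sa_carrier A.U) (sa_carrier B.U)"
    using f by (simp_all add: star_iso_def)
  have g_eqI: "?g x = a" if "a \<in> sa_carrier A.U" "f a = x" for a x
    using that bij by (auto simp: inverse_hom_def bij_betw_def)
  have g: "?g x \<in> sa_carrier A.U" "f (?g x) = x" if "x \<in> sa_carrier B.U" for x
    using that bij by (auto simp: inverse_hom_def bij_betw_def inv_into_into f_inv_into_f)
  have fg: "f (sa_add A.U a b) = sa_add B.U (f a) (f b)" "f (sa_mult A.U a b) = sa_mult B.U (f a) (f b)"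
    if "a \<in> sa_carrier A.U" "b \<in> sa_carrier A.U" for a b
    using hom that by (simp_all add: star_hom_def)
  have fg': "f (sa_scale A.U c a) = sa_scale B.U c (f a)" "f (sa_star A.U a) = sa_star B.U (f a)"
    if "a \<in> sa_carrier A.U" for a c
    using hom that by (simp_all add: star_hom_def)
  show ?thesis
    unfolding star_hom_def
    by (auto intro!: g_eqI A.carrier_add A.carrier_mult A.carrier_scale A.carrier_star simp: fg fg' g)
qed

end

lemma graph_gens_simps [simp]:
  "Inl u \<in> graph_gens E \<longleftrightarrow> u \<in> verts E" "Inr e \<in> graph_gens E \<longleftrightarrow> e \<in> arcs E"
  by (auto simp: graph_gens_def)

lemma graph_relsI:
  "u \<in> verts E \<Longrightarrow> free_star (vgen u) - vgen u \<in> graph_rels E"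
  "u \<in> verts E \<Longrightarrow> vgen u * vgen u - vgen u \<in> graph_rels E"
  "e \<in> arcs E \<Longrightarrow> free_star (egen e) * egen e - vgen (head E e) \<in> graph_rels E"
  "u \<in> reg E \<Longrightarrow> vgen u - (\<Sum>e\<in>out_arcs E u. egen e * free_star (egen e)) \<in> graph_rels E"
  unfolding graph_rels_def
  subgoal by (rule UnI1, rule UnI1, rule UnI1, rule UnI1, rule UnI1, rule UnI1) blast
  subgoal by (rule UnI1, rule UnI1, rule UnI1, rule UnI1, rule UnI1, rule UnI2) blast
  subgoal by (rule UnI1, rule UnI1, rule UnI1, rule UnI2) blast
  subgoal by (rule UnI2) blast
  done

lemma gen_mem:
  "u \<in> verts E \<Longrightarrow> vgen u \<in> free_star_alg (graph_gens E)"
  "e \<in> arcs E \<Longrightarrow> egen e \<in> free_star_alg (graph_gens E)"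
  by (simp_all add: free_gen_mem)

section \<open>Boundedness of the graph relations\<close>

context wf_digraph
begin

text \<open>A vertex is a projection up to null elements, so its seminorm equals its own square; for
  an edge, the squared seminorm is that of its target.\<close>

lemma gen_le_one:
  assumes p: "cstar_seminorm (graph_gens G) p" and null: "\<forall>r\<in>graph_rels G. p r = 0"
    and g: "g \<in> graph_gens G"
  shows "p (free_gen g) \<le> 1"
proof -
  interpret cstar_seminorm_on "free_star_alg (graph_gens G)" free_star free_scale p
    using p by (simp add: cstar_seminorm_iff)
  have vertex: "p (vgen u) \<le> 1" if u: "u \<in> verts G" for u
  proof -
    note m = gen_mem(1)[OF u]
    have 1: "p (free_star (vgen u) * vgen u - vgen u * vgen u) = 0"
      unfolding left_diff_distrib[symmetric]
      by (intro null_mult_left[OF _ _ bspec[OF null graph_relsI(1)[OF u]]] mem m)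
    have 2: "p (vgen u * vgen u - vgen u) = 0"
      by (rule bspec[OF null graph_relsI(2)[OF u]])
    have "p (free_star (vgen u) * vgen u - vgen u) = 0"
      by (rule null_trans[OF _ _ _ 1 2]) (intro mem m)+
    then have "(p (vgen u))\<^sup>2 = p (vgen u)"
      using p_eq_if_null[of "free_star (vgen u) * vgen u" "vgen u"] m by (simp add: mem cstar)
    then show ?thesis
      by (auto simp: power2_eq_square)
  qed
  have "p (egen e) \<le> 1" if e: "e \<in> arcs G" for e
  proof -
    note m = gen_mem(2)[OF e]
    have h: "head G e \<in> verts G" using e by simp
    have "p (free_star (egen e) * egen e - vgen (head G e)) = 0"
      by (rule bspec[OF null graph_relsI(3)[OF e]])
    then have "(p (egen e))\<^sup>2 = p (vgen (head G e))"
      using p_eq_if_null[of "free_star (egen e) * egen e" "vgen (head G e)"] m gen_mem(1)[OF h]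
      by (simp add: mem cstar)
    then show ?thesis
      using power2_le_imp_le[of "p (egen e)" 1] vertex[OF h] by simp
  qed
  then show ?thesis using vertex g by (auto simp: graph_gens_def)
qed

lemma graph_bounded_relations: "bounded_relations (graph_gens G) (graph_rels G)"
proof
  define adm where "adm p \<longleftrightarrow> cstar_seminorm (graph_gens G) p \<and> (\<forall>r\<in>graph_rels G. p r = 0)" for p
  have adm: "cstar_seminorm_on (free_star_alg (graph_gens G)) free_star free_scale p" if "adm p" for p
    using that by (simp add: adm_def cstar_seminorm_iff)
  fix a assume "a \<in> free_star_alg (graph_gens G)"
  \<comment> \<open>The sign of \<open>M\<close> is carried along for products.\<close>
  then have "\<exists>M\<ge>0. \<forall>p. adm p \<longrightarrow> p a \<le> M"
  proof (induction a rule: free_star_alg_induct)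
    case (gen g)
    then show ?case using gen_le_one by (intro exI[of _ 1]) (auto simp: adm_def)
  next
    case (add a b)
    then obtain M N where M: "0 \<le> M" "\<And>p. adm p \<Longrightarrow> p a \<le> M" and N: "0 \<le> N" "\<And>p. adm p \<Longrightarrow> p b \<le> N"
      by metis
    have "p (a + b) \<le> M + N" if p: "adm p" for p
      using cstar_seminorm_on.triangle[OF adm[OF p] add.hyps] M(2)[OF p] N(2)[OF p] by simp
    then show ?case using M N by (intro exI[of _ "M + N"]) simp
  next
    case (mult a b)
    then obtain M N where M: "0 \<le> M" "\<And>p. adm p \<Longrightarrow> p a \<le> M" and N: "0 \<le> N" "\<And>p. adm p \<Longrightarrow> p b \<le> N"
      by metis
    have "p (a * b) \<le> M * N" if p: "adm p" for p
    proof -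
      have "p a * p b \<le> M * N"
        using M N p cstar_seminorm_on.nonneg[OF adm[OF p]] mult.hyps by (intro mult_mono) auto
      then show ?thesis
        using cstar_seminorm_on.submult[OF adm[OF p] mult.hyps] by simp
    qed
    then show ?case using M N by (intro exI[of _ "M * N"]) simp
  next
    case (star a)
    then show ?case using cstar_seminorm_on.p_star[OF adm] by metis
  next
    case (scale a c)
    then obtain M where M: "0 \<le> M" "\<And>p. adm p \<Longrightarrow> p a \<le> M"
      by metis
    have "p (free_scale c a) \<le> cmod c * M" if p: "adm p" for p
      using cstar_seminorm_on.scale[OF adm[OF p] scale.hyps] M(2)[OF p] by (simp add: mult_left_mono)
    then show ?case using M by (intro exI[of _ "cmod c * M"]) simp
  next
    case zero
    have "p 0 \<le> 0" if "adm p" for p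
      using cstar_seminorm_on.p_zero[OF adm[OF that]] by simp
    then show ?case by auto
  qed
  then show "\<exists>M. \<forall>p. cstar_seminorm (graph_gens G) p \<and> (\<forall>r\<in>graph_rels G. p r = 0) \<longrightarrow> p a \<le> M"
    unfolding adm_def by auto
qed

section \<open>Consequences of the graph relations\<close>

interpretation bounded_relations "graph_gens G" "graph_rels G"
  by (rule graph_bounded_relations)

lemma S_vertex_eq: "S_vertex G u = cls (\<lambda>_. vgen u)"
  and S_edge_eq: "S_edge G e = cls (\<lambda>_. egen e)"
  by (simp_all add: S_vertex_def S_edge_def univ_gen_def)

lemma S_edge_in_carrier: "e \<in> arcs G \<Longrightarrow> S_edge G e \<in> sa_carrier (graph_cstar G)"
  by (simp add: S_edge_eq graph_cstar_def cls_mem CS_const gen_mem)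

text \<open>A letter outside the alphabet gives a constant sequence outside \<open>CS\<close>, which
  is related to nothing. This value excludes \<open>w = v\<close> in the end.\<close>

lemma S_edge_empty: 
  assumes "e \<notin> arcs G"
  shows "S_edge G e = {}"
proof -
  have "(\<lambda>_. egen e :: ('a + 'b) free_elem) \<notin> CS"
    using assms CS_mem[of "\<lambda>_. egen e"] by (auto simp: free_star_alg_def free_gen_def)
  then show ?thesis
    by (auto simp: S_edge_eq univ_class_def univ_rel_def)
qed

lemma empty_not_in_graph_cstar: "{} \<notin> sa_carrier (graph_cstar G)"
  unfolding graph_cstar_def by (rule empty_not_in_carrier)

lemma null_vertex_star: "u \<in> verts G \<Longrightarrow> P (free_star (vgen u) - vgen u) = 0"
  by (rule P_rel[OF graph_relsI(1)])

lemma null_vertex_idem: "u \<in> verts G \<Longrightarrow> P (vgen u * vgen u - vgen u) = 0"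
  by (rule P_rel[OF graph_relsI(2)])

text \<open>Not itself a relation. By the C*-identity it suffices that
  \<open>free_star z * z\<close> is null for \<open>z = a * h - a\<close>.\<close>

lemma null_edge_head:
  assumes e: "e \<in> arcs G"
  shows "P (egen e * vgen (head G e) - egen e) = 0"
proof -
  define a h :: "('a + 'b) free_elem" where "a = egen e" and "h = vgen (head G e)"
  have m: "a \<in> A" "h \<in> A" using e by (simp_all add: a_def h_def gen_mem)
  have 1: "P (free_star a * a - h) = 0"
    unfolding a_def h_def by (rule P_rel[OF graph_relsI(3)[OF e]])
  have 2: "P (h * h - h) = 0"
    unfolding h_def using e by (intro null_vertex_idem) simp
  \<comment> \<open>The product \<open>free_star z * z\<close> equals
    \<open>free_star h * d - d\<close>, and \<open>d\<close> is null because
    \<open>free_star a * a\<close> agrees with the idempotent \<open>h\<close> up to null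
    elements.\<close>
  define d where "d = free_star a * a * h - free_star a * a"
  have d: "d = (free_star a * a - h) * h + (h * h - h) + (h - free_star a * a)"
    by (simp add: d_def algebra_simps)
  have "P (h - free_star a * a) = 0"
    using 1 P.p_diff_commute[of h "free_star a * a"] m by (simp add: free.mem)
  then have "P d = 0"
    unfolding d using 1 2 by (intro P.null_add P.null_mult_left free.mem m)
  have dm: "d \<in> A" unfolding d_def by (intro free.mem m)
  have "free_star (a * h - a) * (a * h - a) = free_star h * d + - d"
    by (simp add: d_def free.st_diff free.st_mult algebra_simps)
  moreover have "P (free_star h * d + - d) = 0"
    using \<open>P d = 0\<close> dm m by (intro P.null_add P.null_mult_right free.mem) (simp_all add: P.p_minus)
  ultimately have "(P (a * h - a))\<^sup>2 = 0"
    using P.cstar[of "a * h - a"] m by (simp add: free.mem)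
  then show ?thesis by (simp add: a_def h_def)
qed

text \<open>A vertex with exactly one outgoing edge is regular, and the sum in its relation has a
  single term.\<close>

lemma null_single_edge:
  assumes "out_arcs G v = {y}"
  shows "P (egen y * free_star (egen y) - vgen v) = 0"
proof -
  have y: "y \<in> arcs G" "tail G y = v"
    using assms by (auto simp: out_arcs_def)
  then have v: "v \<in> reg G" "v \<in> verts G"
    using assms by (auto simp: reg_def)
  have "P (vgen v - egen y * free_star (egen y)) = 0"
    using P_rel[OF graph_relsI(4)[OF v(1)]] assms by simp
  then show ?thesis
    using P.p_diff_commute[of "vgen v" "egen y * free_star (egen y)"] y v
    by (simp add: gen_mem free.mem)
qed

lemma S_gis_vertex_idem:
  assumes u: "u \<in> verts G"
  shows "S_gis G (vertex_idem u) = S_vertex G u"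
proof -
  note m = gen_mem(1)[OF u]
  have "P (vgen u * free_star (vgen u) - vgen u * vgen u) = 0"
    unfolding right_diff_distrib[symmetric] using null_vertex_star[OF u]
    by (intro P.null_mult_right free.mem m)
  then have "P (vgen u * free_star (vgen u) - vgen u) = 0"
    by (intro P.null_trans[OF _ _ _ _ null_vertex_idem[OF u]] free.mem m)
  from cls_const_eqI[OF _ _ this] m show ?thesis
    by (simp add: vertex_idem_def vertex_path_def graph_cstar_def S_vertex_eq
        star_cls_const mult_cls_const free.mem)
qed

lemma S_gis_edge_elem:
  assumes e: "e \<in> arcs G"
  shows "S_gis G (edge_elem G e) = S_edge G e"
proof -
  have h: "head G e \<in> verts G" using e by simp
  note m = gen_mem(2)[OF e] gen_mem(1)[OF h]
  have "P (egen e * free_star (vgen (head G e)) - egen e * vgen (head G e)) = 0"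
    unfolding right_diff_distrib[symmetric] using null_vertex_star[OF h]
    by (intro P.null_mult_right free.mem m)
  then have "P (egen e * free_star (vgen (head G e)) - egen e) = 0"
    by (intro P.null_trans[OF _ _ _ _ null_edge_head[OF e]] free.mem m)
  from cls_const_eqI[OF _ _ this] m show ?thesis
    by (simp add: edge_elem_def edge_path_def vertex_path_def graph_cstar_def
        S_vertex_eq S_edge_eq star_cls_const mult_cls_const free.mem)
qed

text \<open>Sending \<open>v\<close> to \<open>(y, y)\<close> is therefore invisible in the
  C*-algebra.\<close>

lemma S_gis_edge_idem:
  assumes y: "out_arcs G v = {y}"
  shows "S_gis G (edge_idem G y) = S_vertex G v"
proof -
  have "y \<in> arcs G" "tail G y = v"
    using y by (auto simp: out_arcs_def)
  then have ya: "y \<in> arcs G" "v \<in> verts G"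
    by auto
  note m = gen_mem(2)[OF ya(1)] gen_mem(1)[OF ya(2)]
  show ?thesis
    using cls_const_eqI[OF _ _ null_single_edge[OF y]] m
    by (simp add: edge_idem_def edge_path_def graph_cstar_def
        S_vertex_eq S_edge_eq star_cls_const mult_cls_const free.mem)
qed

text \<open>The range projection of \<open>y\<close> is the vertex projection at the target of
  \<open>e\<close>, which \<open>S_e\<close> absorbs on the right.\<close>

lemma S_gis_edge_append:
  assumes e: "e \<in> arcs G" and y: "out_arcs G (head G e) = {y}"
  shows "S_gis G (GPair (path_concat (edge_path G e) (edge_path G y)) (edge_path G y)) = S_edge G e"
proof -
  have ya: "y \<in> arcs G" "head G e \<in> verts G"
    using y e by (auto simp: out_arcs_def)
  note m = gen_mem(2)[OF e] gen_mem(2)[OF ya(1)] gen_mem(1)[OF ya(2)]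
  have "P (egen e * egen y * free_star (egen y) - egen e * vgen (head G e)) = 0"
    unfolding mult.assoc right_diff_distrib[symmetric] using null_single_edge[OF y]
    by (intro P.null_mult_right free.mem m)
  then have "P (egen e * egen y * free_star (egen y) - egen e) = 0"
    by (intro P.null_trans[OF _ _ _ _ null_edge_head[OF e]] free.mem m)
  from cls_const_eqI[OF _ _ this] m show ?thesis
    by (simp add: path_concat_def edge_path_def graph_cstar_def
        S_vertex_eq S_edge_eq star_cls_const mult_cls_const free.mem)
qed

end

text \<open>The candidate \<open>g\<close> witnesses existence in the definite description;
  uniqueness is \<open>star_hom_eqI\<close> on the carrier and extensionality outside.\<close>

lemma induced_hom_eqI:
  assumes E: "wf_digraph E" and F: "wf_digraph F"
    and g: "g \<in> extensional (sa_carrier (graph_cstar E))" "star_hom (graph_cstar E) (graph_cstar F) g"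
    and gv: "\<And>u. u \<in> verts E \<Longrightarrow> g (S_vertex E u) = S_gis F (\<phi> (vertex_idem u))"
    and ge: "\<And>e. e \<in> arcs E \<Longrightarrow> g (S_edge E e) = S_gis F (\<phi> (edge_elem E e))"
  shows "induced_hom E F \<phi> = g"
  unfolding induced_hom_def
proof (rule the_equality)
  interpret bounded_relations_pair "graph_gens E" "graph_rels E" "graph_gens F" "graph_rels F"
    using E F by (simp add: bounded_relations_pair_def wf_digraph.graph_bounded_relations)
  fix h
  assume h: "h \<in> extensional (sa_carrier (graph_cstar E)) \<and>
    star_hom (graph_cstar E) (graph_cstar F) h \<and>
    (\<forall>u\<in>verts E. h (S_vertex E u) = S_gis F (\<phi> (vertex_idem u))) \<and>
    (\<forall>e\<in>arcs E. h (S_edge E e) = S_gis F (\<phi> (edge_elem E e)))"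
  have gen: "h (univ_gen (graph_gens E) (graph_rels E) x) = g (univ_gen (graph_gens E) (graph_rels E) x)"
    if "x \<in> graph_gens E" for x
    using that h gv ge by (auto simp: graph_gens_def S_vertex_def S_edge_def)
  show "h = g"
  proof (rule extensionalityI)
    fix a assume "a \<in> sa_carrier (graph_cstar E)"
    then show "h a = g a"
      using star_hom_eqI[of h g a] h g(2) gen by (simp add: graph_cstar_def)
  qed (use h g in auto)
qed (use g gv ge in blast)

subsection \<open>The graph inverse semigroup as a semigroup of partial injections\<close>

text \<open>
  \<open>(\<alpha>, \<beta>)\<close> acts by \<open>\<beta>\<xi> \<mapsto> \<alpha>\<xi>\<close>, where \<open>\<xi>\<close> may be any list of edges.
\<close>

fun gis_act :: "('v, 'e) gis_elem \<Rightarrow> ('v, 'e) path \<Rightarrow> ('v, 'e) path option" where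
  "gis_act GZero x = None"
| "gis_act (GPair \<alpha> \<beta>) x =
    (if is_prefix \<beta> x then Some (fst \<alpha>, snd \<alpha> @ drop (length (snd \<beta>)) (snd x)) else None)"

lemma is_prefix_iff: "is_prefix \<beta> \<gamma> \<longleftrightarrow> (\<exists>q. \<gamma> = (fst \<beta>, snd \<beta> @ q))"
  by (cases \<gamma>) (auto simp: is_prefix_def prefix_def)

text \<open>\<open>path_concat\<close> discards the source of \<open>path_rest\<close>, so that with
  an explicit remainder \<open>q\<close> the product is a matter of edge lists, without
  \<open>path_target\<close>.\<close>

lemma gis_mult_prefix:
  "gis_mult E (GPair \<alpha> \<beta>) (GPair (fst \<beta>, snd \<beta> @ q) \<delta>) = GPair (fst \<alpha>, snd \<alpha> @ q) \<delta>"
  by (simp add: is_prefix_def path_concat_def path_rest_def)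

lemma gis_mult_prefix':
  "gis_mult E (GPair \<alpha> (fst \<gamma>, snd \<gamma> @ q)) (GPair \<gamma> \<delta>) = GPair \<alpha> (fst \<delta>, snd \<delta> @ q)"
  by (cases \<alpha>; cases \<gamma>; cases \<delta>) (auto simp: is_prefix_def path_concat_def path_rest_def)

lemma path_compare:
  obtains (longer) q where "\<alpha> = (fst \<beta>, snd \<beta> @ q)"
  | (shorter) q where "\<beta> = (fst \<alpha>, snd \<alpha> @ q)"
  | (parallel) "\<not> is_prefix \<alpha> \<beta>" "\<not> is_prefix \<beta> \<alpha>"
  by (auto simp: is_prefix_iff)

lemma gis_act_append: "gis_act (GPair \<alpha> \<beta>) (fst \<beta>, snd \<beta> @ q) = Some (fst \<alpha>, snd \<alpha> @ q)"
  by (simp add: is_prefix_def)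

lemma gis_act_eq_Some_iff:
  "gis_act (GPair \<alpha> \<beta>) x = Some z \<longleftrightarrow> (\<exists>q. x = (fst \<beta>, snd \<beta> @ q) \<and> z = (fst \<alpha>, snd \<alpha> @ q))"
  by (cases x) (auto simp: is_prefix_def prefix_def)

text \<open>Turns the case distinctions of \<open>gis_mult\<close> into composition of partial maps;
  semigroup identities become identities of maps.\<close>

lemma gis_act_mult: "gis_act (gis_mult E s t) = gis_act s \<circ>\<^sub>m gis_act t"
proof (cases s; cases t)
  fix \<alpha> \<beta> \<gamma> \<delta>
  assume st: "s = GPair \<alpha> \<beta>" "t = GPair \<gamma> \<delta>"
  have "gis_act (gis_mult E s t) x = Some z \<longleftrightarrow> (gis_act s \<circ>\<^sub>m gis_act t) x = Some z" for x z
  proof (cases \<beta> \<gamma> rule: path_compare)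
    case (longer q)
    show ?thesis
      unfolding st unfolding longer map_comp_Some_iff gis_mult_prefix' gis_act_eq_Some_iff by (auto simp del: gis_mult.simps)
  next
    case (shorter q)
    show ?thesis
      unfolding st unfolding shorter map_comp_Some_iff gis_mult_prefix gis_act_eq_Some_iff by (auto simp del: gis_mult.simps)
  next
    case parallel
    then have "gis_mult E s t = GZero"
      by (simp add: st)
    moreover have False if "gis_act t x = Some z'" "gis_act s z' = Some z" for z'
    proof -
      from that obtain q q' where *: "(fst \<gamma>, snd \<gamma> @ q) = (fst \<beta>, snd \<beta> @ q')"
        unfolding st gis_act_eq_Some_iff by (auto simp del: gis_mult.simps)
      \<comment> \<open>A common extension makes two paths comparable.\<close>
      then have "prefix (snd \<gamma>) (snd \<beta>) \<or> prefix (snd \<beta>) (snd \<gamma>)"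
        using prefix_same_cases[of "snd \<gamma>" "snd \<gamma> @ q" "snd \<beta>"] by (metis prefixI prod.inject)
      with * parallel show False by (auto simp: is_prefix_def)
    qed
    ultimately show ?thesis by (auto simp: map_comp_Some_iff)
  qed
  then show ?thesis by (metis (no_types) ext option.exhaust)
qed (simp_all add: fun_eq_iff map_comp_def split: option.split)

text \<open>Evaluate at \<open>\<beta>\<close> and at \<open>\<delta>\<close>: each of them extends
  the other, so no remainder is left.\<close>

lemma gis_act_inject:
  assumes "gis_act s = gis_act t"
  shows "s = t"
proof -
  have zero: "gis_act (GPair \<alpha> \<beta>) \<noteq> gis_act GZero" for \<alpha> \<beta> :: "('a, 'b) path"
    using gis_act_append[of \<alpha> \<beta> "[]"] by (metis gis_act.simps(1) option.distinct(1))
  have pair: "\<alpha> = \<gamma> \<and> \<beta> = \<delta>" if "gis_act (GPair \<alpha> \<beta>) = gis_act (GPair \<gamma> \<delta>)"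
    for \<alpha> \<beta> \<gamma> \<delta> :: "('a, 'b) path"
  proof -
    have "gis_act (GPair \<gamma> \<delta>) \<beta> = Some \<alpha>" "gis_act (GPair \<alpha> \<beta>) \<delta> = Some \<gamma>"
      using gis_act_append[of \<alpha> \<beta> "[]"] gis_act_append[of \<gamma> \<delta> "[]"] that by simp_all
    then show ?thesis
      unfolding gis_act_eq_Some_iff by (cases \<alpha>; cases \<beta>; cases \<gamma>; cases \<delta>) auto
  qed
  show ?thesis
    using assms zero pair by (cases s; cases t) metis+
qed

lemma gis_act_star_iff: "gis_act (gis_star s) z = Some x \<longleftrightarrow> gis_act s x = Some z"
  by (cases s) (auto simp: gis_act_eq_Some_iff simp del: gis_act.simps(2))

lemma gis_mult_star_mult: "gis_mult E (gis_mult E s (gis_star s)) s = s"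
  by (cases s) (auto simp: is_prefix_def path_concat_def path_rest_def)

lemma gis_star_star [simp]: "gis_star (gis_star s) = s"
  by (cases s) auto

text \<open>For injective partial maps the two equations force \<open>t\<close> to reverse the graph
  of \<open>s\<close>, which is how \<open>gis_star s\<close> acts.\<close>

lemma gis_inverse_unique:
  assumes "gis_mult E (gis_mult E s t) s = s" "gis_mult E (gis_mult E t s) t = t"
  shows "t = gis_star s"
proof (rule gis_act_inject, rule ext)
  fix z
  have st: "(gis_act s \<circ>\<^sub>m gis_act t) \<circ>\<^sub>m gis_act s = gis_act s"
    "(gis_act t \<circ>\<^sub>m gis_act s) \<circ>\<^sub>m gis_act t = gis_act t"
    using assms gis_act_mult by metis+
  \<comment> \<open>\<open>gis_star r\<close> reverses \<open>r\<close> and is single-valued, so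
    \<open>r\<close> is injective.\<close>
  have inj: "x = x'" if "gis_act r x = Some b" "gis_act r x' = Some b" for r :: "('a, 'b) gis_elem" and x x' b
    using that gis_act_star_iff by (metis option.inject)
  have "gis_act t z = Some x \<longleftrightarrow> gis_act (gis_star s) z = Some x" for x
  proof
    assume t: "gis_act t z = Some x"
    then have "((gis_act t \<circ>\<^sub>m gis_act s) \<circ>\<^sub>m gis_act t) z = Some x" by (simp add: st)
    then obtain z' where "gis_act s x = Some z'" "gis_act t z' = Some x"
      using t by (auto simp: map_comp_Some_iff)
    with inj t show "gis_act (gis_star s) z = Some x"
      by (metis gis_act_star_iff)
  next
    assume "gis_act (gis_star s) z = Some x"
    then have s: "gis_act s x = Some z" by (simp add: gis_act_star_iff)
    then have "((gis_act s \<circ>\<^sub>m gis_act t) \<circ>\<^sub>m gis_act s) x = Some z" by (simp add: st)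
    then obtain x' where "gis_act t z = Some x'" "gis_act s x' = Some z"
      using s by (auto simp: map_comp_Some_iff)
    with inj s show "gis_act t z = Some x" by metis
  qed
  then show "gis_act t z = gis_act (gis_star s) z" by (metis option.exhaust)
qed

subsection \<open>Extended path homomorphisms are determined by vertices and edges\<close>

context wf_digraph
begin

lemma FP_iff: "\<alpha> \<in> FP G \<longleftrightarrow> awalk (fst \<alpha>) (snd \<alpha>) (path_target G \<alpha>)"
  by (cases \<alpha>) (auto simp: FP_def path_target_def)

lemma FP_E: "(u, p) \<in> FP G \<longleftrightarrow> (\<exists>t. awalk u p t)"
  by (simp add: FP_def)

lemma path_target_eq: "awalk u p t \<Longrightarrow> path_target G (u, p) = t"
  by (auto simp: path_target_def)

lemma gis_star_mem: "s \<in> gis G \<Longrightarrow> gis_star s \<in> gis G"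
  by (auto simp: gis_def)

text \<open>The image of \<open>gis_star s\<close> satisfies the equations of an inverse of the
  image of \<open>s\<close>. The hypotheses on the two products allow \<open>\<psi>\<close> to be
  applied to them.\<close>

lemma ext_path_hom_star:
  assumes \<psi>: "ext_path_hom G F \<psi>" and s: "s \<in> gis G" "gis_mult G s (gis_star s) \<in> gis G"
    "gis_mult G (gis_star s) s \<in> gis G"
  shows "\<psi> (gis_star s) = gis_star (\<psi> s)"
proof (rule gis_inverse_unique[where E = F])
  have s': "gis_star s \<in> gis G" by (rule gis_star_mem[OF s(1)])
  have hom: "\<psi> (gis_mult G a b) = gis_mult F (\<psi> a) (\<psi> b)" if "a \<in> gis G" "b \<in> gis G" for a b
    using \<psi> that by (simp add: ext_path_hom_def)
  show "gis_mult F (gis_mult F (\<psi> s) (\<psi> (gis_star s))) (\<psi> s) = \<psi> s"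
    by (simp add: hom[symmetric] s s' gis_mult_star_mult)
  show "gis_mult F (gis_mult F (\<psi> (gis_star s)) (\<psi> s)) (\<psi> (gis_star s)) = \<psi> (gis_star s)"
    using gis_mult_star_mult[of G "gis_star s"] by (simp add: hom[symmetric] s s')
qed

lemma gis_pair_iff:
  "GPair \<alpha> \<beta> \<in> gis G \<longleftrightarrow> \<alpha> \<in> FP G \<and> \<beta> \<in> FP G \<and> path_target G \<alpha> = path_target G \<beta>"
  by (cases \<alpha>; cases \<beta>) (auto simp: gis_def)

text \<open>With \<open>t\<close> the common target, \<open>(\<alpha>, \<beta>)\<close> is
  \<open>(\<alpha>, t)\<close> times the adjoint of \<open>(\<beta>, t)\<close>. Such factors are
  products of edge elements and a vertex, and adjoints are preserved.\<close>

lemma ext_path_hom_unique: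
  assumes \<phi>: "ext_path_hom G F \<phi>" "has_values G \<phi>0 \<phi>1 \<phi>"
    and \<psi>: "ext_path_hom G F \<psi>" "has_values G \<phi>0 \<phi>1 \<psi>"
    and s: "s \<in> gis G"
  shows "\<psi> s = \<phi> s"
proof -
  have hom: "\<phi> (gis_mult G a b) = gis_mult F (\<phi> a) (\<phi> b)" "\<psi> (gis_mult G a b) = gis_mult F (\<psi> a) (\<psi> b)"
    if "a \<in> gis G" "b \<in> gis G" for a b
    using \<phi> \<psi> that by (simp_all add: ext_path_hom_def)
  have path: "GPair (u, p) (t, []) \<in> gis G \<and> \<psi> (GPair (u, p) (t, [])) = \<phi> (GPair (u, p) (t, []))"
    if "awalk u p t" for u p t
    using that
  proof (induction p arbitrary: u)
    case Nil
    then have "u = t" "u \<in> verts G" by (auto simp: awalk_Nil_iff)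
    then show ?case
      using \<phi>(2) \<psi>(2)
      by (auto simp: has_values_def vertex_idem_def vertex_path_def gis_pair_iff FP_E awalk_Nil_iff)
  next
    case (Cons e p)
    then have e: "e \<in> arcs G" "u = tail G e" and p: "awalk (head G e) p t"
      by (auto simp: awalk_Cons_iff)
    have t: "t \<in> verts G" using p by auto
    have head: "head G e \<in> verts G" using e by simp
    have mem: "edge_elem G e \<in> gis G" "GPair (u, e # p) (t, []) \<in> gis G"
      using e Cons.prems t head
      by (auto simp: edge_elem_def edge_path_def vertex_path_def gis_pair_iff FP_E awalk_simps
          path_target_eq[of _ _ "head G e"] path_target_eq[of _ _ t])
    have eq: "GPair (u, e # p) (t, []) = gis_mult G (edge_elem G e) (GPair (head G e, p) (t, []))"
      using gis_mult_prefix[of G "(u, [e])" "(head G e, [])" p "(t, [])"] e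
      by (simp add: edge_elem_def edge_path_def vertex_path_def)
    have "\<psi> (edge_elem G e) = \<phi> (edge_elem G e)"
      using \<phi>(2) \<psi>(2) e by (simp add: has_values_def)
    then show ?case
      using Cons.IH[OF p] mem unfolding eq by (simp add: hom)
  qed
  show ?thesis
  proof (cases s)
    case GZero
    then show ?thesis using \<phi> \<psi> by (simp add: ext_path_hom_def)
  next
    case (GPair \<alpha> \<beta>)
    define t where "t = path_target G \<alpha>"
    have w: "awalk (fst \<alpha>) (snd \<alpha>) t" "awalk (fst \<beta>) (snd \<beta>) t"
      using s GPair by (auto simp: gis_pair_iff FP_iff t_def)
    define a b where "a = GPair \<alpha> (t, [])" and "b = GPair \<beta> (t, [])"
    have a: "a \<in> gis G" "\<psi> a = \<phi> a" and b: "b \<in> gis G" "\<psi> b = \<phi> b"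
      using path[OF w(1)] path[OF w(2)] by (simp_all add: a_def b_def)
    have t: "GPair (t, []) (t, []) \<in> gis G"
      using w by (auto simp: gis_pair_iff FP_E awalk_Nil_iff)
    have bb: "GPair \<beta> \<beta> \<in> gis G"
      using s GPair by (simp add: gis_pair_iff)
    have "gis_mult G b (gis_star b) = GPair \<beta> \<beta>" "gis_mult G (gis_star b) b = GPair (t, []) (t, [])"
      using gis_mult_prefix[of G \<beta> "(t, [])" "[]" \<beta>] gis_mult_prefix[of G "(t, [])" \<beta> "[]" "(t, [])"]
      by (simp_all add: b_def)
    then have star: "\<psi> (gis_star b) = gis_star (\<psi> b)" "\<phi> (gis_star b) = gis_star (\<phi> b)"
      using ext_path_hom_star[OF \<psi>(1) b(1)] ext_path_hom_star[OF \<phi>(1) b(1)] t bb by simp_all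
    have "s = gis_mult G a (gis_star b)"
      using gis_mult_prefix[of G \<alpha> "(t, [])" "[]" \<beta>] by (simp add: GPair a_def b_def)
    then show ?thesis
      using a b star by (simp add: hom gis_star_mem)
  qed
qed

end

subsection \<open>The homomorphism of the shift\<close>

text \<open>
  The image of a path of the shift that starts at \<open>u\<close>: a path ending at \<open>v\<close> is prolonged by \<open>y\<close>, and
  \<open>x\<^bsub>w,v\<^esub>\<close> becomes \<open>x = \<theta>(y)\<close> and cancels the \<open>y\<close> that follows.
\<close>

fun unshift :: "('v, 'e) pre_digraph \<Rightarrow> 'v \<Rightarrow> 'e \<Rightarrow> 'e \<Rightarrow> 'v \<Rightarrow> 'e option list \<Rightarrow> 'e list" where
  "unshift E v y x u [] = (if u = v then [y] else [])"
| "unshift E v y x u (Some e # p) = e # unshift E v y x (head E e) p"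
| "unshift E v y x u (None # p) = x # tl (unshift E v y x v p)"

text \<open>As \<open>w\<close> differs from \<open>v\<close>, the edges \<open>y\<close> and
  \<open>\<theta> y\<close> have different sources; hence \<open>y\<close> survives in the shift and
  is still the only edge leaving \<open>v\<close>.\<close>

locale single_shift = E: wf_digraph E
  for E :: "('v, 'e) pre_digraph" +
  fixes v w :: 'v and y :: 'e and \<theta> :: "'e \<Rightarrow> 'e"
  assumes v: "v \<in> verts E" and w: "w \<in> verts E" and neq: "w \<noteq> v"
    and y: "out_arcs E v = {y}"
    and x: "\<theta> y \<in> out_arcs E w" and heads: "head E y = head E (\<theta> y)"
begin

definition "F = shift E v w \<theta>"

lemma y_simps: "y \<in> arcs E" "tail E y = v"
  using y by (auto simp: out_arcs_def)

lemma y_unique: "e \<in> arcs E \<Longrightarrow> tail E e = v \<Longrightarrow> e = y"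
  using y by (auto simp: out_arcs_def)

lemma x_simps: "\<theta> y \<in> arcs E" "tail E (\<theta> y) = w"
  using x by auto

lemma F_simps:
  "verts F = verts E" "arcs F = insert None (Some ` (arcs E - {\<theta> y}))"
  "tail F None = w" "tail F (Some e) = tail E e" "head F None = v" "head F (Some e) = head E e"
  using y by (auto simp: F_def shift_def)

sublocale F: wf_digraph F
  by standard (auto simp: F_simps v w)

abbreviation "hat \<equiv> unshift E v y (\<theta> y)"

text \<open>Ensures that the \<open>tl\<close> in \<open>unshift\<close> removes a \<open>y\<close>:
  from \<open>v\<close> the path is empty and gets prolonged by \<open>y\<close>, or it begins with
  \<open>Some y\<close>.\<close>

lemma hat_v:
  assumes "F.awalk v p t"
  shows "\<exists>q. hat v p = y # q"
proof (cases p)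
  case (Cons e q)
  then have "e \<in> arcs F" "tail F e = v"
    using assms by (auto simp: F.awalk_Cons_iff)
  then have "e = Some y"
    using neq y_unique by (cases e) (auto simp: F_simps)
  then show ?thesis by (simp add: Cons)
qed simp

text \<open>If the middle vertex is \<open>v\<close>, the image of \<open>p\<close> already ends
  with the \<open>y\<close> that opens the image of \<open>q\<close>; this \<open>y\<close> must be
  counted once.\<close>

lemma hat_append:
  assumes "F.awalk u p m" "F.awalk m q t"
  shows "hat u (p @ q) = hat u p @ drop (if m = v then 1 else 0) (hat m q)"
  using assms
proof (induction p arbitrary: u)
  case Nil
  then have "u = m" by (simp add: F.awalk_Nil_iff)
  moreover have "\<exists>r. hat v q = y # r" if "m = v"
    using hat_v that Nil.prems by blast
  ultimately show ?case by auto
next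
  case (Cons e p)
  then have p: "F.awalk (head F e) p m" by (auto simp: F.awalk_Cons_iff)
  show ?case
  proof (cases e)
    case None
    \<comment> \<open>The image of the remaining path is nonempty, so \<open>tl\<close> commutes
      with appending.\<close>
    then obtain r where "hat v p = y # r"
      using hat_v p by (auto simp: F_simps)
    then show ?thesis
      using Cons.IH[OF p Cons.prems(2)] None by (simp add: F_simps)
  next
    case (Some e')
    then show ?thesis
      using Cons.IH[OF p Cons.prems(2)] by (simp add: F_simps)
  qed
qed

text \<open>Prolongation by \<open>y\<close> moves the target \<open>v\<close> to
  \<open>head E y\<close>. At the new edge the leading \<open>y\<close> of the remaining image is
  exchanged for \<open>\<theta> y\<close>, which by \<open>heads\<close> has the same target, so
  that the rest still fits.\<close>

lemma hat_walk:
  assumes "F.awalk u p t"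
  shows "E.awalk u (hat u p) (if t = v then head E y else t)"
  using assms
proof (induction p arbitrary: u)
  case Nil
  then show ?case
    using y_simps by (auto simp: F.awalk_Nil_iff E.awalk_simps F_simps)
next
  case (Cons e p)
  then have e: "e \<in> arcs F" "u = tail F e" and p: "F.awalk (head F e) p t"
    by (auto simp: F.awalk_Cons_iff)
  show ?case
  proof (cases e)
    case None
    then obtain r where r: "hat v p = y # r"
      using hat_v p by (auto simp: F_simps)
    have "u = w" using e None by (simp add: F_simps)
    moreover have "E.awalk v (y # r) (if t = v then head E y else t)"
      using Cons.IH[OF p] unfolding None F_simps r .
    then have "E.awalk (head E (\<theta> y)) r (if t = v then head E y else t)"
      unfolding E.awalk_Cons_iff heads by blast
    ultimately show ?thesis
      unfolding None unshift.simps r E.awalk_Cons_iff using x_simps by simp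
  next
    case (Some e')
    then show ?thesis
      using Cons.IH[OF p] e by (auto simp: F_simps E.awalk_Cons_iff)
  qed
qed

text \<open>At the first difference the walks leave a common vertex by different edges, and the
  images differ at the corresponding place.\<close>

lemma hat_parallel:
  assumes p: "F.awalk u p t" and q: "F.awalk u q t'" and "p \<parallel> q"
  shows "hat u p \<parallel> hat u q"
proof -
  obtain r b bs c cs where bc: "b \<noteq> c" "p = r @ b # bs" "q = r @ c # cs"
    using parallel_decomp[OF assms(3)] by blast
  define m where "m = F.awlast u r"
  have r: "F.awalk u r m" and bw: "F.awalk m (b # bs) t" and cw: "F.awalk m (c # cs) t'"
    using p q by (auto simp: bc m_def)
  have arcs: "b \<in> arcs F" "tail F b = m" "c \<in> arcs F" "tail F c = m"
    using bw cw by (auto simp: F.awalk_Cons_iff)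
  have "d = Some y" if "d \<in> arcs F" "tail F d = v" for d
    using that neq y_unique by (cases d) (auto simp: F_simps)
  \<comment> \<open>Two different edges leave \<open>m\<close>, but only one leaves
    \<open>v\<close>. Hence \<open>hat_append\<close> drops nothing at \<open>m\<close>.\<close>
  then have m: "m \<noteq> v" using arcs bc(1) by metis
  have hd: "\<exists>s. hat m (d # ds) = (case d of None \<Rightarrow> \<theta> y | Some e \<Rightarrow> e) # s" for d ds
    by (cases d) auto
  \<comment> \<open>The edge \<open>\<theta> y\<close> is missing from the shift, so the first
    letter for \<open>None\<close> differs from every remaining old edge.\<close>
  have "(case b of None \<Rightarrow> \<theta> y | Some e \<Rightarrow> e) \<noteq> (case c of None \<Rightarrow> \<theta> y | Some e \<Rightarrow> e)"
    using arcs bc(1) by (auto simp: F_simps split: option.splits)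
  then have "hat m (b # bs) \<parallel> hat m (c # cs)"
    using hd[of b bs] hd[of c cs] by auto
  then show ?thesis
    using m by (simp add: bc hat_append[OF r bw] hat_append[OF r cw] parallel_def)
qed

section \<open>The induced map on pairs of paths\<close>

definition hat_path :: "('v, 'e option) path \<Rightarrow> ('v, 'e) path" where
  "hat_path \<alpha> = (fst \<alpha>, hat (fst \<alpha>) (snd \<alpha>))"

fun phi :: "('v, 'e option) gis_elem \<Rightarrow> ('v, 'e) gis_elem" where
  "phi GZero = GZero"
| "phi (GPair \<alpha> \<beta>) = GPair (hat_path \<alpha>) (hat_path \<beta>)"

lemma phi_mem: "s \<in> gis F \<Longrightarrow> phi s \<in> gis E"
proof (cases s)
  case (GPair \<alpha> \<beta>)
  moreover assume "s \<in> gis F"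
  ultimately have
    "F.awalk (fst \<alpha>) (snd \<alpha>) (path_target F \<alpha>)" "F.awalk (fst \<beta>) (snd \<beta>) (path_target F \<alpha>)"
    by (auto simp: F.gis_pair_iff F.FP_iff)
  from hat_walk[OF this(1)] hat_walk[OF this(2)] show ?thesis
    by (auto simp: GPair hat_path_def E.gis_pair_iff E.FP_E E.path_target_eq)
qed (simp add: gis_def)

text \<open>The appended piece depends only on the common target \<open>m\<close> and on
  \<open>q\<close>, so both entries of a pair grow by the same list.\<close>

lemma phi_append:
  assumes "F.awalk u p m" "F.awalk u' p' m" "F.awalk m q t"
  obtains r where "hat u (p @ q) = hat u p @ r" "hat u' (p' @ q) = hat u' p' @ r"
  using hat_append[OF assms(1,3)] hat_append[OF assms(2,3)] by blast

text \<open>Comparable inner paths stay comparable with a shared remainder, by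
  \<open>phi_append\<close>; incomparable ones stay incomparable, by
  \<open>hat_parallel\<close>.\<close>

lemma phi_mult:
  assumes "s \<in> gis F" "t \<in> gis F"
  shows "phi (gis_mult F s t) = gis_mult E (phi s) (phi t)"
proof (cases s; cases t)
  fix \<alpha> \<beta> \<gamma> \<delta>
  assume st: "s = GPair \<alpha> \<beta>" "t = GPair \<gamma> \<delta>"
  define m n where "m = path_target F \<beta>" and "n = path_target F \<gamma>"
  have walks: "F.awalk (fst \<alpha>) (snd \<alpha>) m" "F.awalk (fst \<beta>) (snd \<beta>) m"
    "F.awalk (fst \<gamma>) (snd \<gamma>) n" "F.awalk (fst \<delta>) (snd \<delta>) n"
    using assms by (auto simp: st F.gis_pair_iff F.FP_iff m_def n_def)
  show ?thesis
  proof (cases \<beta> \<gamma> rule: path_compare)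
    case (longer q)
    then have q: "F.awalk n q m"
      using walks by auto
    obtain r where r: "hat (fst \<gamma>) (snd \<gamma> @ q) = hat (fst \<gamma>) (snd \<gamma>) @ r"
      "hat (fst \<delta>) (snd \<delta> @ q) = hat (fst \<delta>) (snd \<delta>) @ r"
      using phi_append[OF walks(3,4) q] .
    have "phi (GPair \<alpha> (fst \<gamma>, snd \<gamma> @ q)) =
        GPair (hat_path \<alpha>) (fst (hat_path \<gamma>), snd (hat_path \<gamma>) @ r)"
      "phi (GPair \<alpha> (fst \<delta>, snd \<delta> @ q)) =
        GPair (hat_path \<alpha>) (fst (hat_path \<delta>), snd (hat_path \<delta>) @ r)"
      by (simp_all add: hat_path_def r)
    then show ?thesis
      unfolding st unfolding longer gis_mult_prefix' by (simp only: phi.simps(2) gis_mult_prefix')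
  next
    case (shorter q)
    then have q: "F.awalk m q n"
      using walks by auto
    obtain r where r: "hat (fst \<beta>) (snd \<beta> @ q) = hat (fst \<beta>) (snd \<beta>) @ r"
      "hat (fst \<alpha>) (snd \<alpha> @ q) = hat (fst \<alpha>) (snd \<alpha>) @ r"
      using phi_append[OF walks(2,1) q] .
    have "phi (GPair (fst \<beta>, snd \<beta> @ q) \<delta>) =
        GPair (fst (hat_path \<beta>), snd (hat_path \<beta>) @ r) (hat_path \<delta>)"
      "phi (GPair (fst \<alpha>, snd \<alpha> @ q) \<delta>) =
        GPair (fst (hat_path \<alpha>), snd (hat_path \<alpha>) @ r) (hat_path \<delta>)"
      by (simp_all add: hat_path_def r)
    moreover have "phi (GPair (fst \<beta>, snd \<beta> @ q) \<delta>) = GPair (hat_path (fst \<beta>, snd \<beta> @ q)) (hat_path \<delta>)"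
      by simp
    ultimately show ?thesis
      unfolding st unfolding shorter gis_mult_prefix by (simp only: phi.simps(2) gis_mult_prefix)
  next
    case parallel
    have "\<not> is_prefix (hat_path \<beta>) (hat_path \<gamma>) \<and> \<not> is_prefix (hat_path \<gamma>) (hat_path \<beta>)"
    proof (cases "fst \<beta> = fst \<gamma>")
      case True
      then have "snd \<beta> \<parallel> snd \<gamma>"
        using parallel by (auto simp: is_prefix_def)
      then have "hat (fst \<beta>) (snd \<beta>) \<parallel> hat (fst \<beta>) (snd \<gamma>)"
        using walks True by (intro hat_parallel[of _ _ m _ n]) auto
      then show ?thesis using True by (auto simp: is_prefix_def hat_path_def)
    qed (auto simp: is_prefix_def hat_path_def)
    with parallel show ?thesis by (simp add: st)
  qed
qed simp_all

lemma phi_vertex: "phi (vertex_idem u) = (if u \<noteq> v then vertex_idem u else edge_idem E y)"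
  by (simp add: vertex_idem_def vertex_path_def edge_idem_def edge_path_def hat_path_def y_simps)

lemma phi_edge:
  "phi (edge_elem F e) = (case e of
      None \<Rightarrow> GPair (edge_path E (\<theta> y)) (edge_path E y)
    | Some e' \<Rightarrow> (if head E e' \<noteq> v then edge_elem E e'
        else GPair (path_concat (edge_path E e') (edge_path E y)) (edge_path E y)))"
  by (simp add: edge_elem_def edge_path_def vertex_path_def path_concat_def hat_path_def
      y_simps x_simps F_simps split: option.split)

lemma phi_hom: "ext_path_hom F E phi"
  by (auto simp: ext_path_hom_def phi_mem phi_mult)

lemma phi_determines:
  "determines F E (\<lambda>u. if u \<noteq> v then vertex_idem u else edge_idem E y)
    (\<lambda>e. case e of
        None \<Rightarrow> GPair (edge_path E (\<theta> y)) (edge_path E y)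
      | Some e' \<Rightarrow> (if head E e' \<noteq> v then edge_elem E e'
          else GPair (path_concat (edge_path E e') (edge_path E y)) (edge_path E y))) phi"
  (is "determines F E ?\<phi>0 ?\<phi>1 phi")
proof -
  have "has_values F ?\<phi>0 ?\<phi>1 phi"
    by (simp only: has_values_def phi_vertex phi_edge) simp
  then show ?thesis
    unfolding determines_def using phi_hom F.ext_path_hom_unique by blast
qed

lemma gis_le_idem:
  assumes "gis_le E t (GPair \<zeta> \<zeta>)" "t \<noteq> GZero"
  obtains \<alpha> where "t = GPair \<alpha> \<alpha>" "is_prefix \<zeta> \<alpha>"
proof (cases t)
  case (GPair \<alpha> \<beta>)
  have "gis_mult E t (gis_star t) = GPair \<alpha> \<alpha>"
    using gis_mult_prefix[of E \<alpha> \<beta> "[]" \<alpha>] by (simp add: GPair)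
  then have le: "gis_mult E (GPair \<alpha> \<alpha>) (GPair \<zeta> \<zeta>) = GPair \<alpha> \<beta>"
    using assms by (simp add: gis_le_def GPair)
  show ?thesis
  proof (cases \<alpha> \<zeta> rule: path_compare)
    case (longer q)
    then have "\<beta> = \<alpha>" using le gis_mult_prefix'[of E \<alpha> \<zeta> q \<zeta>] by simp
    then show ?thesis using that[of \<alpha>] GPair longer is_prefix_iff by blast
  next
    \<comment> \<open>Here the product is \<open>(\<zeta>, \<zeta>)\<close>, and comparison with
      \<open>t\<close> leaves only equality.\<close>
    case (shorter q)
    then have "\<alpha> = \<zeta>" "\<beta> = \<zeta>" using le gis_mult_prefix[of E \<alpha> \<alpha> q \<zeta>] by simp_all
    then show ?thesis using that[of \<alpha>] GPair by (simp add: is_prefix_def)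
  next
    case parallel
    then show ?thesis using le by simp
  qed
qed (use assms in simp)

text \<open>Below the image of a vertex lie only idempotents \<open>(\<alpha>, \<alpha>)\<close>, so
  a nonzero product means that \<open>\<alpha>\<close> is comparable with the image of some edge.
  The first edge of \<open>\<alpha>\<close> selects it.\<close>

lemma phi_regular: "regular_hom F E phi"
  unfolding regular_hom_def
proof (intro ballI impI)
  fix u t
  assume u: "u \<in> reg F" and t: "t \<in> gis E" "t \<noteq> GZero \<and> gis_le E t (phi (vertex_idem u))"
  obtain \<alpha> where \<alpha>: "t = GPair \<alpha> \<alpha>" "is_prefix (hat_path (vertex_path u)) \<alpha>"
    using gis_le_idem[of t "hat_path (vertex_path u)"] t by (auto simp: vertex_idem_def)
  then obtain a where a: "\<alpha> = (u, a)"
    by (cases \<alpha>) (auto simp: is_prefix_def hat_path_def vertex_path_def)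
  have walk: "E.awalk u a (path_target E \<alpha>)"
    using t \<alpha> by (simp add: E.gis_pair_iff E.FP_iff a)
  have "\<exists>e\<in>out_arcs F u. prefix a (hat u [e]) \<or> prefix (hat u [e]) a"
  proof (cases a)
    case Nil
    \<comment> \<open>The empty path is comparable with everything; regularity of \<open>u\<close>
      supplies an edge.\<close>
    then show ?thesis using u by (auto simp: reg_def)
  next
    case (Cons e b)
    then have e: "e \<in> arcs E" "tail E e = u" and b: "E.awalk (head E e) b (path_target E \<alpha>)"
      using walk by (auto simp: E.awalk_Cons_iff)
    show ?thesis
    proof (cases "e = \<theta> y")
      case True
      \<comment> \<open>The image of \<open>None\<close> is \<open>[\<theta> y]\<close>: the
        prolonging \<open>y\<close> is cancelled at once.\<close>
      have "None \<in> out_arcs F w"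
        by (simp add: F_simps)
      moreover have "u = w" "prefix (hat u [None]) a"
        using True e x_simps Cons by simp_all
      ultimately show ?thesis by blast
    next
      case False
      then have "Some e \<in> out_arcs F u"
        using e by (simp add: F_simps)
      \<comment> \<open>If \<open>e\<close> ends at \<open>v\<close>, its image is
        \<open>[e, y]\<close>, and \<open>a\<close> can continue only with \<open>y\<close>.\<close>
      moreover have "b = [] \<or> (\<exists>c. b = y # c)" if "head E e = v"
        using b that y_unique by (cases b) (auto simp: E.awalk_Cons_iff)
      then have "prefix a (hat u [Some e]) \<or> prefix (hat u [Some e]) a"
        by (auto simp: Cons)
      ultimately show ?thesis by blast
    qed
  qed
  then obtain e where e: "e \<in> out_arcs F u" and pre: "prefix a (hat u [e]) \<or> prefix (hat u [e]) a"
    by blast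
  have "phi (edge_idem F e) = GPair (u, hat u [e]) (u, hat u [e])"
    using e by (simp add: edge_idem_def edge_path_def hat_path_def)
  then have "gis_mult E t (phi (edge_idem F e)) \<noteq> GZero"
    using pre by (auto simp: \<alpha> a is_prefix_def)
  then show "\<exists>e\<in>out_arcs F u. gis_mult E t (phi (edge_idem F e)) \<noteq> GZero"
    using e by blast
qed

end

section \<open>Comparison with the inverse isomorphism on generators\<close>

theorem theorem5p16:
  fixes E :: "('v, 'e) pre_digraph" and v w :: 'v and y :: 'e and \<theta> :: "'e \<Rightarrow> 'e"
    and F :: "('v, 'e option) pre_digraph"
    and f :: "('v + 'e) univ_elem \<Rightarrow> ('v + 'e option) univ_elem"
    and g :: "('v + 'e option) univ_elem \<Rightarrow> ('v + 'e) univ_elem"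
  assumes graph: "wf_digraph E"
    and vw: "v \<in> verts E" "w \<in> verts E"
    and theta: "\<theta> \<in> out_arcs E v \<rightarrow> out_arcs E w"
    and y: "out_arcs E v = {y}" "head E y = head E (\<theta> y)"
    and F_def: "F = shift E v w \<theta>"
    and f_iso: "star_iso (graph_cstar E) (graph_cstar F) f"
    and f_vertex: "\<And>u. u \<in> verts E \<Longrightarrow> f (S_vertex E u) = S_vertex F u"
    and f_edge: "\<And>e. e \<in> arcs E - {\<theta> y} \<Longrightarrow> f (S_edge E e) = S_edge F (Some e)"
    and f_theta: "f (S_edge E (\<theta> y)) =
      sa_mult (graph_cstar F) (S_edge F None) (S_edge F (Some y))"
    and g_def: "g = inverse_hom (graph_cstar E) (graph_cstar F) f"
    and g_vertex: "\<And>u. u \<in> verts E \<Longrightarrow> g (S_vertex F u) = S_vertex E u"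
    and g_edge: "\<And>e. Some e \<in> arcs F \<Longrightarrow> g (S_edge F (Some e)) = S_edge E e"
    and g_new: "g (S_edge F None) =
      sa_mult (graph_cstar E) (S_edge E (\<theta> y)) (sa_star (graph_cstar E) (S_edge E y))"
  shows "\<exists>\<phi>. determines F E
           (\<lambda>u. if u \<noteq> v then vertex_idem u else edge_idem E y)
           (\<lambda>e. case e of
               None \<Rightarrow> GPair (edge_path E (\<theta> y)) (edge_path E y)
             | Some e' \<Rightarrow>
                 (if head E e' \<noteq> v then edge_elem E e'
                  else GPair (path_concat (edge_path E e') (edge_path E y)) (edge_path E y)))
           \<phi>
         \<and> regular_hom F E \<phi>
         \<and> induced_hom F E \<phi> = g"
proof -
  interpret E: wf_digraph E by (rule graph)
  let ?CE = "graph_cstar E" and ?CF = "graph_cstar F"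
  have y_arc: "y \<in> arcs E" "tail E y = v"
    using y(1) by (auto simp: out_arcs_def)
  have theta_y: "\<theta> y \<in> out_arcs E w"
    using theta y(1) by auto
  have F: "wf_digraph F"
    by standard (auto simp: F_def shift_def vw)
  have "w \<noteq> v"
  proof
    assume "w = v"
    \<comment> \<open>Now \<open>\<theta> y\<close> leaves \<open>v\<close> as well, hence is
      \<open>y\<close> and is removed.\<close>
    then have "Some y \<notin> arcs F"
      using theta_y y(1) by (auto simp: F_def shift_def)
    \<comment> \<open>A product with an empty class is an empty union.\<close>
    then have "f (S_edge E (\<theta> y)) = {}"
      by (simp add: f_theta wf_digraph.S_edge_empty[OF F] graph_cstar_def univ_cstar_def)
    moreover have "f (S_edge E (\<theta> y)) \<in> sa_carrier ?CF"
      using f_iso E.S_edge_in_carrier theta_y by (auto simp: star_iso_def star_hom_def)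
    ultimately show False
      using wf_digraph.empty_not_in_graph_cstar[OF F] by simp
  qed
  then interpret s: single_shift E v w y \<theta>
    using vw y theta_y by unfold_locales auto
  have Fs: "F = s.F"
    by (simp add: F_def s.F_def)
  interpret bounded_relations_pair "graph_gens E" "graph_rels E" "graph_gens F" "graph_rels F"
    using graph F by (simp add: bounded_relations_pair_def wf_digraph.graph_bounded_relations)
  have "induced_hom F E s.phi = g"
  proof (rule induced_hom_eqI[OF F graph])
    show "g \<in> extensional (sa_carrier ?CF)"
      by (simp add: g_def inverse_hom_def)
    show "star_hom ?CF ?CE g"
      using star_hom_inverse f_iso unfolding g_def graph_cstar_def by blast
    show "g (S_vertex F u) = S_gis E (s.phi (vertex_idem u))" if "u \<in> verts F" for u
    proof -
      have "u \<in> verts E" using that by (simp add: Fs s.F_simps)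
      then show ?thesis
        using g_vertex E.S_gis_vertex_idem E.S_gis_edge_idem[OF y(1)]
        by (simp add: s.phi_vertex)
    qed
    show "g (S_edge F e) = S_gis E (s.phi (edge_elem F e))" if e: "e \<in> arcs F" for e
    proof (cases e)
      case None
      then show ?thesis
        unfolding Fs s.phi_edge by (simp add: g_new[unfolded Fs] edge_path_def)
    next
      case (Some e')
      then have e': "e' \<in> arcs E" using e by (auto simp: Fs s.F_simps)
      have "g (S_edge F e) = S_edge E e'"
        using g_edge e Some by simp
      then show ?thesis
        unfolding Fs s.phi_edge using Some E.S_gis_edge_elem[OF e'] E.S_gis_edge_append[OF e'] y(1)
        by simp
    qed
  qed
  then show ?thesis
    using s.phi_determines s.phi_regular unfolding Fs by blast
qed

end
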